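(* Let $1<q<\infty$ with $q\neq 2$, let $G$ be a finite bi-coloured multigraph, and let $(G,p)$ be a completely regular non-Euclidean direction-length framework in $(\mathbb{R}^2,\|\cdot\|_q)$, with red edges constraining the $\|\cdot\|_q$-distance and blue edges constraining direction. Then $(G,p)$ is minimally rigid if and only if $G$ is $(2,2)$-tight and $(2,3)$-limited.
   Context: A bi-coloured multigraph $G=(V,E)$ is a finite loopless multigraph with nonempty vertex set, each of whose edges is coloured blue or red, with no two parallel edges of the same colour. $K(V)$ is the complete bi-coloured multigraph on $V$, with one blue and one red edge between each pair of distinct vertices. For $k\in\{2,3\}$, a multigraph is $(2,k)$-sparse if $|E'|\le 2|V'|-k$ for all subgraphs $(V',E')$ with $|E'|>0$ (parallel edges counted with multiplicity); it is $(2,k)$-tight if moreover $|E|=2|V|-k$. A bi-coloured multigraph is $(2,3)$-limited if every subgraph all of whose edges are blue is $(2,3)$-sparse. A direction-length framework $(G,p)$ in $(\mathbb{R}^2,\|\cdot\|_q)$ is a bi-coloured multigraph with a placement $p:V\to\mathbb{R}^2$ whose joints have pairwise distinct first coordinates. Write $p(v)=(x_v,y_v)$. A red edge $vw$ constrains $d_r(p(v),p(w))=\|p(v)-p(w)\|_q$. A blue edge $vw$ is a direction constraint, expressed by the separation $d_b(p(v),p(w))=(y_v-y_w)^2/(x_v-x_w)^2$. The rigidity matrix is the $|E|\times 2|V|$ Jacobian matrix at $p$ of the map sending a placement to its tuple of edge separations; its kernel is the space of infinitesimal flexes. $(G,p)$ is (infinitesimally) rigid if its rigidity matrix has rank $2|V|-2$,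 and minimally rigid if moreover $(G-e,p)$ is not rigid for every edge $e$. $(G,p)$ is completely regular if for every subgraph $H$ of $K(V)$ the rigidity matrix of $(H,p|_H)$ has maximal rank over all placements of $H$. *)

theory Defs
  imports "HOL-Analysis.Analysis"
begin

section \<open>Bi-coloured multigraphs\<close>

datatype colour = Blue | Red

instance colour :: finite
proof
  have "(UNIV :: colour set) = {Blue, Red}"
    using colour.exhaust by blast
  then show "finite (UNIV :: colour set)"
    by (metis finite.emptyI finite.insertI)
qed

text \<open>
  An edge is a pair of a two-element vertex set and a colour. As the edges form a set,
  there are no two parallel edges of the same colour, while a blue and a red edge on the
  same pair of vertices are distinct edges and are counted separately by \<open>card\<close>.
\<close>

type_synonym 'v edge = "'v set \<times> colour"

record 'v bigraph =
  verts :: "'v set"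
  edges :: "'v edge set"

definition complete_bigraph :: "'v set \<Rightarrow> 'v bigraph" where
  "complete_bigraph V =
     \<lparr>verts = V, edges = {({v, w}, c) | v w c. v \<in> V \<and> w \<in> V \<and> v \<noteq> w}\<rparr>"

definition bicoloured_multigraph :: "'v bigraph \<Rightarrow> bool" where
  "bicoloured_multigraph G \<longleftrightarrow>
     finite (verts G) \<and> verts G \<noteq> {} \<and>
     (\<forall>(e, c) \<in> edges G. \<exists>v w. e = {v, w} \<and> v \<noteq> w \<and> v \<in> verts G \<and> w \<in> verts G)"

definition subgraph :: "'v bigraph \<Rightarrow> 'v bigraph \<Rightarrow> bool" where
  "subgraph H G \<longleftrightarrow>
     bicoloured_multigraph H \<and> verts H \<subseteq> verts G \<and> edges H \<subseteq> edges G"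

definition delete_edge :: "'v bigraph \<Rightarrow> 'v edge \<Rightarrow> 'v bigraph" where
  "delete_edge G e = \<lparr>verts = verts G, edges = edges G - {e}\<rparr>"

definition sparse2 :: "int \<Rightarrow> 'v bigraph \<Rightarrow> bool" where
  "sparse2 k G \<longleftrightarrow>
     (\<forall>H. subgraph H G \<and> card (edges H) > 0 \<longrightarrow>
        int (card (edges H)) \<le> 2 * int (card (verts H)) - k)"

definition tight2 :: "int \<Rightarrow> 'v bigraph \<Rightarrow> bool" where
  "tight2 k G \<longleftrightarrow>
     sparse2 k G \<and> int (card (edges G)) = 2 * int (card (verts G)) - k"

definition limited23 :: "'v bigraph \<Rightarrow> bool" where
  "limited23 G \<longleftrightarrow>
     (\<forall>H. subgraph H G \<and> (\<forall>(e, c) \<in> edges H. c = Blue) \<longrightarrow> sparse2 3 H)"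


section \<open>Direction-length frameworks\<close>

definition lq_norm :: "real \<Rightarrow> real^2 \<Rightarrow> real" where
  "lq_norm q a = (\<bar>a $ 1\<bar> powr q + \<bar>a $ 2\<bar> powr q) powr (1 / q)"

fun separation :: "real \<Rightarrow> colour \<Rightarrow> real^2 \<Rightarrow> real^2 \<Rightarrow> real" where
  "separation q Red a b = lq_norm q (a - b)"
| "separation q Blue a b = (a $ 2 - b $ 2)\<^sup>2 / (a $ 1 - b $ 1)\<^sup>2"

definition edge_separation :: "real \<Rightarrow> ('v \<Rightarrow> real^2) \<Rightarrow> 'v edge \<Rightarrow> real" where
  "edge_separation q p = (\<lambda>(e, c). THE d. \<exists>v w. e = {v, w} \<and> d = separation q c (p v) (p w))"

lemma separation_commute: "separation q c a b = separation q c b a"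
  by (cases c) (simp_all add: lq_norm_def power2_commute abs_minus_commute)

lemma edge_separation_insert [simp]:
  "edge_separation q p ({v, w}, c) = separation q c (p v) (p w)"
  unfolding edge_separation_def
  by (auto intro!: the_equality simp: doubleton_eq_iff separation_commute)

definition placement :: "'v set \<Rightarrow> ('v \<Rightarrow> real^2) \<Rightarrow> bool" where
  "placement V p \<longleftrightarrow> inj_on (\<lambda>v. p v $ 1) V"

text \<open>
  The vertices of all graphs lie in a finite type \<open>'v\<close>, and the rows and columns of rigidity
  matrices are indexed by all of \<open>'v edge\<close> and \<open>'v \<times> 2\<close>. The rows of non-edges and the columns
  of non-vertices are zero: the matrix is the usual one, of size
  \<open>card (edges G)\<close> times \<open>2 * card (verts G)\<close>, padded with zeros, and has the same rank.
  The values of \<open>p\<close> outside \<open>verts G\<close> play no role, so that \<open>p\<close> also serves as its own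
  restriction to a subgraph.
\<close>

definition coords :: "('v::finite \<Rightarrow> real^2) \<Rightarrow> real^('v \<times> 2)" where
  "coords p = (\<chi> vi. p (fst vi) $ snd vi)"

definition joints :: "real^('v \<times> 2) \<Rightarrow> ('v::finite \<Rightarrow> real^2)" where
  "joints z v = (\<chi> i. z $ (v, i))"

definition rigidity_map ::
    "real \<Rightarrow> 'v::finite bigraph \<Rightarrow> real^('v \<times> 2) \<Rightarrow> real^('v edge)" where
  "rigidity_map q G z =
     (\<chi> e. if e \<in> edges G then edge_separation q (joints z) e else 0)"

definition rigidity_matrix ::
    "real \<Rightarrow> 'v::finite bigraph \<Rightarrow> ('v \<Rightarrow> real^2) \<Rightarrow> real^('v \<times> 2)^('v edge)" where
  "rigidity_matrix q G p = jacobian (rigidity_map q G) (at (coords p))"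

definition framework :: "'v bigraph \<Rightarrow> ('v \<Rightarrow> real^2) \<Rightarrow> bool" where
  "framework G p \<longleftrightarrow> bicoloured_multigraph G \<and> placement (verts G) p"

definition rigid :: "real \<Rightarrow> 'v::finite bigraph \<Rightarrow> ('v \<Rightarrow> real^2) \<Rightarrow> bool" where
  "rigid q G p \<longleftrightarrow>
     int (rank (rigidity_matrix q G p)) = 2 * int (card (verts G)) - 2"

definition minimally_rigid :: "real \<Rightarrow> 'v::finite bigraph \<Rightarrow> ('v \<Rightarrow> real^2) \<Rightarrow> bool" where
  "minimally_rigid q G p \<longleftrightarrow>
     rigid q G p \<and> (\<forall>e \<in> edges G. \<not> rigid q (delete_edge G e) p)"

definition completely_regular :: "real \<Rightarrow> 'v::finite bigraph \<Rightarrow> ('v \<Rightarrow> real^2) \<Rightarrow> bool" where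
  "completely_regular q G p \<longleftrightarrow>
     (\<forall>H. subgraph H (complete_bigraph (verts G)) \<longrightarrow>
        (\<forall>p'. placement (verts H) p' \<longrightarrow>
           rank (rigidity_matrix q H p') \<le> rank (rigidity_matrix q H p)))"


subsection \<open>The rigidity map is differentiable at every framework\<close>

text \<open>
  Hence \<^const>\<open>jacobian\<close>, which is unspecified at points of non-differentiability, is the
  matrix of partial derivatives in all uses above.
\<close>

lemma abs_powr_has_real_derivative_0:
  assumes "1 < (q::real)"
  shows "((\<lambda>t::real. \<bar>t\<bar> powr q) has_real_derivative 0) (at 0)"
proof -
  have ev: "\<forall>\<^sub>F h in at (0::real). \<bar>h\<bar> powr (q - 1) = norm ((\<bar>0 + h\<bar> powr q - \<bar>0\<bar> powr q) / h)"
    using assms by (auto simp: eventually_at_filter powr_diff)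
  have "((\<lambda>h::real. \<bar>h\<bar> powr (q - 1)) \<longlongrightarrow> \<bar>0\<bar> powr (q - 1)) (at 0)"
    by (rule tendsto_powr') (use assms in \<open>auto intro!: tendsto_rabs_zero\<close>)
  then have "((\<lambda>h::real. \<bar>h\<bar> powr (q - 1)) \<longlongrightarrow> 0) (at 0)"
    by simp
  then have "((\<lambda>h. norm ((\<bar>0 + h\<bar> powr q - \<bar>0\<bar> powr q) / h)) \<longlongrightarrow> 0) (at (0::real))"
    using ev by (simp add: tendsto_cong)
  then show ?thesis
    unfolding DERIV_def by (rule tendsto_norm_zero_cancel)
qed

lemma abs_powr_differentiable:
  assumes "1 < (q::real)"
  shows "(\<lambda>t::real. \<bar>t\<bar> powr q) differentiable (at t)"
proof (cases "t = 0")
  case True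
  then show ?thesis
    using abs_powr_has_real_derivative_0[OF assms] real_differentiable_def by blast
next
  case False
  have "\<bar>s\<bar> powr q = (s\<^sup>2) powr (q / 2)" for s :: real
  proof (cases "s = 0")
    case False
    then have "s\<^sup>2 = \<bar>s\<bar> powr 2"
      by (simp add: powr_numeral)
    then show ?thesis
      by (simp only: powr_powr) simp
  qed simp
  moreover have "((\<lambda>s::real. (s\<^sup>2) powr (q / 2)) has_real_derivative
      (q / 2) * (t\<^sup>2) powr (q / 2 - 1) * (2 * t)) (at t)"
    using False by (auto intro!: derivative_eq_intros)
  ultimately show ?thesis
    using real_differentiable_def by auto
qed

lemma differentiable_abs_powr_compose:
  fixes f :: "'a::real_normed_vector \<Rightarrow> real"
  assumes "1 < q" "f differentiable (at x)"
  shows "(\<lambda>z. \<bar>f z\<bar> powr q) differentiable (at x)"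
  using differentiable_chain_at[OF assms(2) abs_powr_differentiable[OF assms(1)]]
  by (simp add: o_def)

lemma differentiable_powr_const_compose:
  fixes f :: "'a::real_normed_vector \<Rightarrow> real"
  assumes "f x > 0" "f differentiable (at x)"
  shows "(\<lambda>z. f z powr r) differentiable (at x)"
proof -
  have "((\<lambda>t. t powr r) has_real_derivative r * f x powr (r - 1)) (at (f x))"
    using assms(1) by (auto intro!: derivative_eq_intros)
  then have "(\<lambda>t. t powr r) differentiable (at (f x))"
    using real_differentiable_def by blast
  from differentiable_chain_at[OF assms(2) this] show ?thesis
    by (simp add: o_def)
qed

lemma separation_differentiable:
  fixes p :: "'v::finite \<Rightarrow> real^2"
  assumes q: "1 < q" and ne: "p v $ 1 \<noteq> p w $ 1"
  shows "(\<lambda>z. separation q c (joints z v) (joints z w)) differentiable (at (coords p))"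
proof -
  have d: "(\<lambda>z::real^('v \<times> 2). z $ (v, i) - z $ (w, i)) differentiable (at (coords p))" for i
    by (intro differentiable_diff bounded_linear_imp_differentiable bounded_linear_vec_nth)
  show ?thesis
  proof (cases c)
    case Red
    have "0 < \<bar>coords p $ (v, 1) - coords p $ (w, 1)\<bar> powr q"
      using ne by (simp add: coords_def)
    then have "0 < \<bar>coords p $ (v, 1) - coords p $ (w, 1)\<bar> powr q
                 + \<bar>coords p $ (v, 2) - coords p $ (w, 2)\<bar> powr q"
      by (simp add: add_pos_nonneg)
    then show ?thesis
      using Red q d unfolding Red separation.simps lq_norm_def joints_def
      by (simp add: differentiable_powr_const_compose differentiable_abs_powr_compose
          differentiable_add)
  next
    case Blue
    then show ?thesis
      using ne d by (simp add: joints_def coords_def differentiable_divide differentiable_power)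
  qed
qed

lemma rigidity_map_differentiable:
  fixes G :: "'v::finite bigraph"
  assumes q: "1 < q" and fw: "framework G p"
  shows "rigidity_map q G differentiable (at (coords p))"
proof -
  have "(\<lambda>z. rigidity_map q G z $ e) differentiable (at (coords p))" for e
  proof (cases "e \<in> edges G")
    case True
    then obtain v w c where "e = ({v, w}, c)" "v \<noteq> w" "v \<in> verts G" "w \<in> verts G"
      using fw unfolding framework_def bicoloured_multigraph_def by fastforce
    moreover from this have "p v $ 1 \<noteq> p w $ 1"
      using fw unfolding framework_def placement_def inj_on_def by blast
    ultimately show ?thesis
      using separation_differentiable[OF q] True by (simp add: rigidity_map_def)
  qed (simp add: rigidity_map_def)
  then show ?thesis
    by (subst differentiable_componentwise_within)
      (auto simp: Basis_vec_def inner_axis)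
qed

end

(*
  A row of the rigidity matrix for an edge vw is a scalar multiple of the constraint n . (u(v) - u(w)) = 0,
  where n is obtained from p(v) - p(w) by rotation (blue) or by the odd power map t -> sgn t |t|^(q-1) in
  each coordinate (red). Both choices of n depend continuously on p, even when joints coincide or share a
  coordinate, so independence of the rows at one degenerate placement gives independence at a generic one.

  Necessity: the rows of a subgraph are orthogonal to the translations, and blue rows also to the dilation.

  Sufficiency: by complete regularity it is enough to find one placement with independent rows, by induction
  on the number of vertices. Remove a vertex v of degree at most 3. If the degree is 3, uncrossing of tight
  sets yields an edge f between neighbours of v that may be added to the rest; hence the rest has a flex u
  violating f. If the three edges at v are not all blue, any f will do: placing v at a corner of the grid
  spanned by the coordinates of its neighbours, where normals are parallel to the axes, or close to a
  neighbour, one sees that a flex which extends to every position of v is constant on the neighbours.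
  For three red edges this uses that t -> sgn t |t|^(q-1) is not additive, since q is not 2.
  If all three are blue, f can be chosen blue, and v is placed close to a neighbour.
*)
theory Submission
  imports Defs
begin

section \<open>Independent families of vectors\<close>

text \<open>Two motions explain the case distinction. If all edges at v are blue, the dilation u = p
  is not constant, yet it extends to every position of v; only a blue f excludes it, and so tight
  sets of the blue count must be uncrossed too. For q = 2 and three red edges at v, a rotation would
  extend in the same way. Extending u to v means finding a velocity z with d . (z - u(w)) = 0 for
  each edge vw with normal d. If this is possible, the 3 x 3 determinant of the vectors (d, d .
  u(w)) vanishes. Each position of v is chosen to make this determinant nonzero. The rows are first
  studied without their scalar factors. Corners and limits violate the conditions on a placement,
  and the derivative of a squared slope vanishes on a horizontal blue edge. A perturbation into
  general position leads back to the actual matrix.\<close>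

definition indep_family :: "('e \<Rightarrow> 'a::real_vector) \<Rightarrow> 'e set \<Rightarrow> bool" where
  "indep_family r E \<longleftrightarrow> (\<forall>e\<in>E. r e \<notin> span (r ` (E - {e})))"

lemma sum_in_span_image: "(\<Sum>e\<in>F. k e *\<^sub>R r e) \<in> span (r ` F)"
  by (intro span_sum span_scale span_base imageI)

lemma in_span_image_obtain_sum:
  assumes "finite F" and "x \<in> span (r ` F)"
  obtains k where "x = (\<Sum>e\<in>F. k e *\<^sub>R r e)"
proof -
  have "\<exists>k. x = (\<Sum>e\<in>F. k e *\<^sub>R r e)"
    using assms
  proof (induction F arbitrary: x rule: finite_induct)
    case (insert e F)
    then obtain c where "x - c *\<^sub>R r e \<in> span (r ` F)"
      by (auto simp: span_insert)
    then obtain k where "x - c *\<^sub>R r e = (\<Sum>e\<in>F. k e *\<^sub>R r e)"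
      using insert.IH by blast
    then have "x = c *\<^sub>R r e + (\<Sum>e\<in>F. k e *\<^sub>R r e)"
      by (simp add: algebra_simps)
    also have "(\<Sum>e\<in>F. k e *\<^sub>R r e) = (\<Sum>d\<in>F. (k(e := c)) d *\<^sub>R r d)"
      using insert.hyps by (intro sum.cong) auto
    finally have "x = (\<Sum>d\<in>insert e F. (k(e := c)) d *\<^sub>R r d)"
      using insert.hyps by simp
    then show ?case by blast
  qed simp
  then show ?thesis using that by blast
qed

lemma indep_family_iff:
  assumes "finite E"
  shows "indep_family r E \<longleftrightarrow> (\<forall>k. (\<Sum>e\<in>E. k e *\<^sub>R r e) = 0 \<longrightarrow> (\<forall>e\<in>E. k e = 0))"
proof
  assume ind: "indep_family r E"
  show "\<forall>k. (\<Sum>e\<in>E. k e *\<^sub>R r e) = 0 \<longrightarrow> (\<forall>e\<in>E. k e = 0)"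
  proof (intro allI impI ballI, rule ccontr)
    fix k e assume k: "(\<Sum>e\<in>E. k e *\<^sub>R r e) = 0" and e: "e \<in> E" "k e \<noteq> 0"
    have "(\<Sum>e\<in>E. k e *\<^sub>R r e) = k e *\<^sub>R r e + (\<Sum>d\<in>E - {e}. k d *\<^sub>R r d)"
      using assms e by (simp add: sum.remove)
    with k have "k e *\<^sub>R r e = - (\<Sum>d\<in>E - {e}. k d *\<^sub>R r d)"
      by (simp add: eq_neg_iff_add_eq_0)
    then have "k e *\<^sub>R r e \<in> span (r ` (E - {e}))"
      by (simp add: span_neg sum_in_span_image)
    then have "(1 / k e) *\<^sub>R (k e *\<^sub>R r e) \<in> span (r ` (E - {e}))"
      by (rule span_scale)
    then show False
      using ind e by (simp add: indep_family_def)
  qed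
next
  assume *: "\<forall>k. (\<Sum>e\<in>E. k e *\<^sub>R r e) = 0 \<longrightarrow> (\<forall>e\<in>E. k e = 0)"
  show "indep_family r E"
    unfolding indep_family_def
  proof (intro ballI notI)
    fix e assume e: "e \<in> E" and "r e \<in> span (r ` (E - {e}))"
    then obtain k where k: "r e = (\<Sum>d\<in>E - {e}. k d *\<^sub>R r d)"
      using in_span_image_obtain_sum[of "E - {e}"] assms by blast
    have "(\<Sum>d\<in>E. (k(e := - 1)) d *\<^sub>R r d) = - r e + (\<Sum>d\<in>E - {e}. (k(e := - 1)) d *\<^sub>R r d)"
      using assms e by (simp add: sum.remove)
    also have "(\<Sum>d\<in>E - {e}. (k(e := - 1)) d *\<^sub>R r d) = (\<Sum>d\<in>E - {e}. k d *\<^sub>R r d)"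
      by (intro sum.cong) auto
    finally have "(k(e := - 1)) e = 0"
      using * e k by (metis add.commute add.right_inverse)
    then show False by simp
  qed
qed

text \<open>Indexing by edges makes two edges with equal rows dependent. Hence \<open>r\<close> is
  injective on \<open>E\<close>, and no edge is lost in passing to the image set.\<close>

lemma indep_family_dim:
  assumes "finite E" and "indep_family r E"
  shows "dim (r ` E) = card E"
proof -
  have "inj_on r E"
  proof (rule inj_onI, rule ccontr)
    fix d e assume "d \<in> E" "e \<in> E" "r d = r e" "d \<noteq> e"
    then have "e \<in> E - {d}" by simp
    then have "r e \<in> span (r ` (E - {d}))" by (intro span_base imageI)
    then show False
      using assms(2) \<open>d \<in> E\<close> \<open>r d = r e\<close> by (metis indep_family_def)
  qed
  moreover have "independent (r ` E)"
  proof
    assume "dependent (r ` E)"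
    then obtain e where e: "e \<in> E" "r e \<in> span (r ` E - {r e})"
      unfolding dependent_def by blast
    moreover have "span (r ` E - {r e}) \<subseteq> span (r ` (E - {e}))"
      by (intro span_mono) blast
    ultimately show False
      using assms(2) unfolding indep_family_def by blast
  qed
  ultimately show ?thesis
    by (simp add: card_image dim_eq_card_independent)
qed

lemma indep_family_mono:
  assumes "indep_family r E" and "F \<subseteq> E"
  shows "indep_family r F"
proof -
  have "span (r ` (F - {e})) \<subseteq> span (r ` (E - {e}))" for e
    using assms(2) by (intro span_mono image_mono) blast
  then show ?thesis
    using assms unfolding indep_family_def by blast
qed

lemma indep_family_cong:
  assumes "\<And>e. e \<in> E \<Longrightarrow> r e = s e"
  shows "indep_family r E \<longleftrightarrow> indep_family s E"
proof -
  have "r ` (E - {e}) = s ` (E - {e})" for e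
    using assms by (intro image_cong) auto
  then show ?thesis
    using assms by (simp add: indep_family_def)
qed

lemma indep_family_scale:
  assumes "finite E" and "indep_family r E" and "\<And>e. e \<in> E \<Longrightarrow> c e \<noteq> 0"
    and "\<And>e. e \<in> E \<Longrightarrow> s e = c e *\<^sub>R r e"
  shows "indep_family s E"
  unfolding indep_family_iff[OF assms(1)]
proof (intro allI impI)
  fix k assume "(\<Sum>e\<in>E. k e *\<^sub>R s e) = 0"
  then have "(\<Sum>e\<in>E. (k e * c e) *\<^sub>R r e) = 0"
    using assms(4) by simp
  then have "\<forall>e\<in>E. k e * c e = 0"
    using assms(1,2) indep_family_iff[of E r] by fastforce
  then show "\<forall>e\<in>E. k e = 0"
    using assms(3) by simp
qed

text \<open>Independence is an open condition. Forming combinations is linear and injective on a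
  finite-dimensional space of coefficients, hence bounded below by some \<open>B\<close>; rows that
  move by less than \<open>B\<close> in total cannot acquire a relation.\<close>

lemma eventually_indep_family:
  fixes r :: "'b \<Rightarrow> 'e::finite \<Rightarrow> 'a::euclidean_space"
  assumes lim: "\<And>e. e \<in> E \<Longrightarrow> ((\<lambda>t. r t e) \<longlongrightarrow> r0 e) F"
    and ind: "indep_family r0 E"
  shows "\<forall>\<^sub>F t in F. indep_family (r t) E"
proof -
  define S where "S = {k :: real^'e. \<forall>e. e \<notin> E \<longrightarrow> k $ e = 0}"
  define f where "f = (\<lambda>k :: real^'e. \<Sum>e\<in>E. (k $ e) *\<^sub>R r0 e)"
  have sub: "subspace S"
    by (auto simp: S_def subspace_def)
  have "bounded_linear f"
    unfolding f_def
    by (intro bounded_linear_sum bounded_linear_scaleR_const bounded_linear_vec_nth)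
  moreover have "\<forall>k\<in>S. f k = 0 \<longrightarrow> k = 0"
  proof (intro ballI impI)
    fix k assume "k \<in> S" "f k = 0"
    moreover from this have "\<forall>e\<in>E. k $ e = 0"
      using ind by (simp add: f_def indep_family_iff)
    ultimately show "k = 0"
      by (auto simp: S_def vec_eq_iff)
  qed
  ultimately obtain B where B: "B > 0" "\<And>k. k \<in> S \<Longrightarrow> B * norm k \<le> norm (f k)"
    using injective_imp_isometric[OF closed_subspace[OF sub] sub] by blast
  have "((\<lambda>t. \<Sum>e\<in>E. norm (r t e - r0 e)) \<longlongrightarrow> (\<Sum>e\<in>E. norm (r0 e - r0 e))) F"
    by (intro tendsto_sum tendsto_norm tendsto_diff lim tendsto_const)
  then have "\<forall>\<^sub>F t in F. (\<Sum>e\<in>E. norm (r t e - r0 e)) < B"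
    using B(1) by (intro order_tendstoD) auto
  then show ?thesis
  proof eventually_elim
    case (elim t)
    show "indep_family (r t) E"
      unfolding indep_family_iff[OF finite]
    proof (intro allI impI)
      fix k assume k: "(\<Sum>e\<in>E. k e *\<^sub>R r t e) = 0"
      define l :: "real^'e" where "l = (\<chi> e. if e \<in> E then k e else 0)"
      have "f l = (\<Sum>e\<in>E. k e *\<^sub>R r0 e) - (\<Sum>e\<in>E. k e *\<^sub>R r t e)"
        using k by (simp add: f_def l_def)
      also have "\<dots> = (\<Sum>e\<in>E. k e *\<^sub>R (r0 e - r t e))"
        by (simp add: sum_subtractf scaleR_diff_right)
      finally have "norm (f l) \<le> (\<Sum>e\<in>E. norm (k e *\<^sub>R (r0 e - r t e)))"
        by (simp add: sum_norm_le)
      also have "\<dots> \<le> (\<Sum>e\<in>E. norm l * norm (r t e - r0 e))"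
      proof (rule sum_mono)
        fix e assume "e \<in> E"
        then have "\<bar>k e\<bar> \<le> norm l"
          using component_le_norm_cart[of l e] by (simp add: l_def)
        then show "norm (k e *\<^sub>R (r0 e - r t e)) \<le> norm l * norm (r t e - r0 e)"
          by (simp add: norm_minus_commute mult_right_mono)
      qed
      finally have "norm (f l) \<le> norm l * (\<Sum>e\<in>E. norm (r t e - r0 e))"
        by (simp add: sum_distrib_left)
      moreover have "B * norm l \<le> norm (f l)"
        using B(2) by (simp add: S_def l_def)
      ultimately have "norm l * B \<le> norm l * (\<Sum>e\<in>E. norm (r t e - r0 e))"
        by (simp add: mult.commute)
      then have "l = 0"
        using elim by (cases "l = 0") auto
      then have "(if e \<in> E then k e else 0) = 0" for e
        unfolding l_def by (simp add: vec_eq_iff split: if_splits)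
      then show "\<forall>e\<in>E. k e = 0"
        by presburger
    qed
  qed
qed

text \<open>The witness is the component of \<open>r f\<close> orthogonal to the span of the other
  rows. For rows of edges it is a flex of \<open>E\<close> that violates \<open>f\<close>.\<close>

lemma indep_family_insert_obtain:
  fixes r :: "'e \<Rightarrow> 'a::euclidean_space"
  assumes "indep_family r (insert f E)" and "f \<notin> E"
  obtains u where "\<And>e. e \<in> E \<Longrightarrow> r e \<bullet> u = 0" and "r f \<bullet> u \<noteq> 0"
proof -
  obtain y z where yz: "y \<in> span (r ` E)" "\<And>w. w \<in> span (r ` E) \<Longrightarrow> orthogonal z w"
      "r f = y + z"
    using orthogonal_subspace_decomp_exists by blast
  have "r f \<notin> span (r ` E)"
    using assms by (auto simp: indep_family_def)
  then have "z \<noteq> 0"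
    using yz by auto
  moreover have "r f \<bullet> z = z \<bullet> z"
    using yz(2)[OF yz(1)] yz(3) by (simp add: inner_add_left orthogonal_def inner_commute[of z y])
  moreover have "r e \<bullet> z = 0" if "e \<in> E" for e
    using yz(2)[of "r e"] that by (simp add: span_base orthogonal_def inner_commute)
  ultimately show ?thesis
    using that[of z] by auto
qed

text \<open>Reading off the coordinates in \<open>T\<close> is injective on the span. In the rank
  bounds \<open>T\<close> omits the coordinates that orthogonality to trivial motions
  recovers.\<close>

lemma dim_le_card_determining:
  fixes S :: "(real^'n) set"
  assumes "\<And>z. \<lbrakk>z \<in> span S; \<And>j. j \<in> T \<Longrightarrow> z $ j = 0\<rbrakk> \<Longrightarrow> z = 0"
  shows "dim S \<le> card T"
proof -
  define f :: "real^'n \<Rightarrow> real^'n" where "f = (\<lambda>z. \<Sum>j\<in>T. (z $ j) *\<^sub>R axis j 1)"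
  have lin: "linear f"
    unfolding f_def by (intro linear_compose_sum ballI linearI) (auto simp: scaleR_add_left)
  have "inj_on f (span S)"
  proof (subst linear_inj_on_iff_eq_0[OF lin subspace_span], intro ballI impI)
    fix z assume z: "z \<in> span S" "f z = 0"
    have "z $ j = 0" if "j \<in> T" for j
    proof -
      have "f z $ j = z $ j"
        using that by (simp add: f_def axis_def if_distrib[of "\<lambda>x. _ * x"] cong: if_cong)
      then show ?thesis using z by simp
    qed
    then show "z = 0" using assms z(1) by blast
  qed
  then have "dim S = dim (f ` S)"
    using dim_image_eq[OF lin] by metis
  also have "f ` S \<subseteq> span ((\<lambda>j. axis j 1) ` T)"
    unfolding f_def by (blast intro: span_sum span_scale span_base)
  then have "dim (f ` S) \<le> card ((\<lambda>j. axis j (1::real)) ` T)"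
    by (intro dim_le_card) auto
  also have "\<dots> \<le> card T"
    by (simp add: card_image_le)
  finally show ?thesis .
qed

text \<open>Cramer's rule: weighting the equations by cofactors isolates one unknown times the
  determinant.\<close>

lemma det3_nonzero_imp_zero:
  fixes x y z :: real
  assumes "x * a1 + y * b1 + z * c1 = 0" "x * a2 + y * b2 + z * c2 = 0" "x * a3 + y * b3 + z * c3 = 0"
    and det: "a1 * (b2 * c3 - b3 * c2) - b1 * (a2 * c3 - a3 * c2) + c1 * (a2 * b3 - a3 * b2) \<noteq> 0"
      (is "?D \<noteq> 0")
  shows "x = 0 \<and> y = 0 \<and> z = 0"
proof -
  have "x * ?D = 0" "y * ?D = 0" "z * ?D = 0"
    using assms(1-3) by algebra+
  then show ?thesis using det by simp
qed

section \<open>Sparsity counts\<close>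

definition induced_edges :: "'v edge set \<Rightarrow> 'v set \<Rightarrow> 'v edge set" where
  "induced_edges E X = {e \<in> E. fst e \<subseteq> X}"

definition blue_edges :: "'v edge set \<Rightarrow> 'v edge set" where
  "blue_edges E = {e \<in> E. snd e = Blue}"

text \<open>Counting over vertex sets suits uncrossing, and an induced subgraph has the most edges
  on its vertices. The blue bound starts at two vertices because one vertex would violate it even
  without edges. Sums avoid truncated subtraction.\<close>

definition count_sparse :: "'v edge set \<Rightarrow> bool" where
  "count_sparse E \<longleftrightarrow>
     (\<forall>X. X \<noteq> {} \<longrightarrow> card (induced_edges E X) + 2 \<le> 2 * card X) \<and>
     (\<forall>X. 2 \<le> card X \<longrightarrow> card (induced_edges (blue_edges E) X) + 3 \<le> 2 * card X)"

definition tight_set :: "'v edge set \<Rightarrow> 'v set \<Rightarrow> bool" where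
  "tight_set E X \<longleftrightarrow> card (induced_edges E X) + 2 = 2 * card X"

definition blue_tight_set :: "'v edge set \<Rightarrow> 'v set \<Rightarrow> bool" where
  "blue_tight_set E X \<longleftrightarrow> card (induced_edges (blue_edges E) X) + 3 = 2 * card X"

lemma blue_edges_subset: "blue_edges E \<subseteq> E"
  by (auto simp: blue_edges_def)

lemma card_induced_edges_mono:
  fixes E :: "'v::finite edge set"
  shows "F \<subseteq> E \<Longrightarrow> X \<subseteq> Y \<Longrightarrow> card (induced_edges F X) \<le> card (induced_edges E Y)"
  by (intro card_mono finite) (auto simp: induced_edges_def)

lemma count_sparseD:
  assumes "count_sparse E" and "X \<noteq> {}"
  shows "card (induced_edges E X) + 2 \<le> 2 * card X"
  using assms by (simp add: count_sparse_def)

lemma count_sparse_blueD: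
  assumes "count_sparse E" and "2 \<le> card X"
  shows "card (induced_edges (blue_edges E) X) + 3 \<le> 2 * card X"
  using assms by (simp add: count_sparse_def)

lemma two_le_cardI:
  fixes X :: "'v::finite set"
  assumes "x \<in> X" "y \<in> X" "x \<noteq> y"
  shows "2 \<le> card X"
proof -
  have "card {x, y} \<le> card X"
    using assms by (intro card_mono) auto
  then show ?thesis using assms by simp
qed

lemma count_sparse_mono:
  fixes E :: "'v::finite edge set"
  assumes "count_sparse E" and "F \<subseteq> E"
  shows "count_sparse F"
proof -
  have "blue_edges F \<subseteq> blue_edges E"
    using assms(2) by (auto simp: blue_edges_def)
  then have "card (induced_edges F X) \<le> card (induced_edges E X)"
    "card (induced_edges (blue_edges F) X) \<le> card (induced_edges (blue_edges E) X)" for X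
    using assms(2) by (simp_all add: card_induced_edges_mono)
  then show ?thesis
    using assms(1) unfolding count_sparse_def by (meson add_le_mono1 le_trans)
qed

text \<open>Edges counted on either side lie inside the union, those counted twice inside the
  intersection. Allowing a smaller set \<open>F\<close> for \<open>Y\<close> lets a tight set be
  uncrossed with a blue tight one.\<close>

lemma induced_edges_supermodular:
  fixes E :: "'v::finite edge set"
  assumes "F \<subseteq> E"
  shows "card (induced_edges E X) + card (induced_edges F Y)
     \<le> card (induced_edges E (X \<union> Y)) + card (induced_edges F (X \<inter> Y))"
proof -
  have "card (induced_edges E X) + card (induced_edges F Y) =
      card (induced_edges E X \<union> induced_edges F Y) + card (induced_edges E X \<inter> induced_edges F Y)"
    by (intro card_Un_Int finite)
  also have "induced_edges E X \<inter> induced_edges F Y = induced_edges F (X \<inter> Y)"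
    using assms by (auto simp: induced_edges_def)
  also have "card (induced_edges E X \<union> induced_edges F Y) \<le> card (induced_edges E (X \<union> Y))"
    using assms by (intro card_mono finite) (auto simp: induced_edges_def)
  finally show ?thesis by simp
qed

text \<open>By sparsity the intersection takes at most twice its size minus 2 of the edges, so
  supermodularity leaves enough for the union to attain its own bound.\<close>

lemma tight_set_Un:
  fixes E :: "'v::finite edge set"
  assumes "count_sparse E" "tight_set E X" "tight_set E Y" "X \<inter> Y \<noteq> {}"
  shows "tight_set E (X \<union> Y)"
proof -
  have "card X + card Y = card (X \<union> Y) + card (X \<inter> Y)"
    by (intro card_Un_Int finite)
  moreover have ne: "X \<union> Y \<noteq> {}" using assms(4) by blast
  ultimately show ?thesis
    using induced_edges_supermodular[OF order_refl, of E X Y] count_sparseD[OF assms(1) ne]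
      count_sparseD[OF assms(1,4)] assms(2,3)
    unfolding tight_set_def by linarith
qed

lemma blue_tight_set_Un:
  fixes E :: "'v::finite edge set"
  assumes "count_sparse E" "blue_tight_set E X" "blue_tight_set E Y" "2 \<le> card (X \<inter> Y)"
  shows "blue_tight_set E (X \<union> Y)"
proof -
  have "card X + card Y = card (X \<union> Y) + card (X \<inter> Y)"
    by (intro card_Un_Int finite)
  moreover have ne: "2 \<le> card (X \<union> Y)"
    using assms(4) card_mono[of "X \<union> Y" "X \<inter> Y"] by fastforce
  ultimately show ?thesis
    using induced_edges_supermodular[OF order_refl, of "blue_edges E" X Y]
      count_sparse_blueD[OF assms(1) ne] count_sparse_blueD[OF assms(1,4)] assms(2,3)
    unfolding blue_tight_set_def by linarith
qed

text \<open>In the intersection only blue edges are counted. Its deficit of at least 3 absorbs that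
  of \<open>Y\<close>, and the deficit 2 of \<open>X\<close> passes to the union.\<close>

lemma tight_set_Un_blue_tight_set:
  fixes E :: "'v::finite edge set"
  assumes "count_sparse E" "tight_set E X" "blue_tight_set E Y" "2 \<le> card (X \<inter> Y)"
  shows "tight_set E (X \<union> Y)"
proof -
  have "card X + card Y = card (X \<union> Y) + card (X \<inter> Y)"
    by (intro card_Un_Int finite)
  moreover have ne: "X \<union> Y \<noteq> {}"
    using assms(4) by fastforce
  ultimately show ?thesis
    using induced_edges_supermodular[OF blue_edges_subset, of E X Y]
      count_sparseD[OF assms(1) ne] count_sparse_blueD[OF assms(1,4)] assms(2,3)
    unfolding blue_tight_set_def tight_set_def by linarith
qed

lemma meet_singleton:
  fixes E :: "'v::finite edge set"
  assumes sp: "count_sparse E"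
    and none: "\<And>W. \<lbrakk>a \<in> W; b \<in> W; c \<in> W\<rbrakk> \<Longrightarrow> \<not> tight_set E W \<and> \<not> blue_tight_set E W"
    and X: "a \<in> X" "b \<in> X" "tight_set E X \<or> blue_tight_set E X"
    and Y: "b \<in> Y" "c \<in> Y" "tight_set E Y \<or> blue_tight_set E Y"
  shows "X \<inter> Y = {b}" and "\<not> (tight_set E X \<and> tight_set E Y)"
proof -
  have no: "\<not> tight_set E (X \<union> Y)" "\<not> blue_tight_set E (X \<union> Y)" "\<not> tight_set E (Y \<union> X)"
    using none[of "X \<union> Y"] none[of "Y \<union> X"] X Y by auto
  show nt: "\<not> (tight_set E X \<and> tight_set E Y)"
    using tight_set_Un[OF sp, of X Y] no X Y by blast
  have "\<not> 2 \<le> card (X \<inter> Y)"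
    using tight_set_Un_blue_tight_set[OF sp, of X Y] tight_set_Un_blue_tight_set[OF sp, of Y X]
      blue_tight_set_Un[OF sp, of X Y] nt no X(3) Y(3) by (auto simp: Int_commute)
  then show "X \<inter> Y = {b}"
    using two_le_cardI[of b "X \<inter> Y"] X Y by blast
qed

lemma count_sparse_induced_singleton:
  fixes E :: "'v::finite edge set"
  assumes "count_sparse E" "F \<subseteq> E"
  shows "induced_edges F {x} = {}"
  using count_sparseD[OF assms(1), of "{x}"] card_induced_edges_mono[OF assms(2), of "{x}" "{x}"]
  by simp

text \<open>Sparsity leaves no edge inside a single vertex, so sets that meet in one vertex share no
  edge.\<close>

lemma card_induced_edges_triangle:
  fixes E :: "'v::finite edge set"
  assumes sp: "count_sparse E" and sub: "F1 \<subseteq> E" "F2 \<subseteq> E" "F3 \<subseteq> E"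
    and int: "X \<inter> Y = {b}" "Y \<inter> Z = {c}" "X \<inter> Z = {a}"
  shows "card (induced_edges F1 X) + card (induced_edges F2 Y) + card (induced_edges F3 Z)
     \<le> card (induced_edges E (X \<union> Y \<union> Z))"
proof -
  have disj: "induced_edges A U \<inter> induced_edges B W = {}"
    if "U \<inter> W = {w}" "A \<subseteq> E" "B \<subseteq> E" for A B U W w
  proof -
    have "induced_edges A U \<inter> induced_edges B W \<subseteq> induced_edges E {w}"
      using that by (auto simp: induced_edges_def)
    then show ?thesis
      using count_sparse_induced_singleton[OF sp order_refl, of w] by simp
  qed
  have "card (induced_edges F1 X) + card (induced_edges F2 Y) + card (induced_edges F3 Z) =
     card (induced_edges F1 X \<union> induced_edges F2 Y \<union> induced_edges F3 Z)"
    using disj[OF int(1) sub(1,2)] disj[OF int(2) sub(2,3)] disj[OF int(3) sub(1,3)]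
    by (simp add: card_Un_disjoint Int_Un_distrib2)
  also have "\<dots> \<le> card (induced_edges E (X \<union> Y \<union> Z))"
    using sub by (intro card_mono finite) (auto simp: induced_edges_def)
  finally show ?thesis .
qed

lemma card_Un_triangle:
  fixes X :: "'v::finite set"
  assumes "X \<inter> Y = {b}" "Y \<inter> Z = {c}" "X \<inter> Z = {a}" "a \<noteq> c"
  shows "card X + card Y + card Z = card (X \<union> Y \<union> Z) + 3"
proof -
  have "(X \<union> Y) \<inter> Z = {a, c}" using assms by blast
  then have "card (X \<union> Y) + card Z = card (X \<union> Y \<union> Z) + 2"
    using card_Un_Int[of "X \<union> Y" Z] assms(4) by simp
  moreover have "card X + card Y = card (X \<union> Y) + 1"
    using card_Un_Int[of X Y] assms(1) by simp
  ultimately show ?thesis by simp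
qed

text \<open>Otherwise each pair lies in a tight or blue tight set, and uncrossing forces these three
  sets to meet pairwise in single vertices, with at most one of them tight. The shared vertices add
  3 to the vertex count, which offsets a deficit of 6. With one tight set the union has deficit at
  most 2 + 3 + 3 - 6 = 2 and is tight; with none its blue deficit is at most 9 - 6 = 3 and it is
  blue tight. Either contradicts \<open>none\<close>.\<close>

lemma untight_pair_of_three:
  fixes E :: "'v::finite edge set"
  assumes sp: "count_sparse E" and dist: "a \<noteq> b" "b \<noteq> c" "a \<noteq> c"
    and none: "\<And>W. \<lbrakk>a \<in> W; b \<in> W; c \<in> W\<rbrakk> \<Longrightarrow> \<not> tight_set E W \<and> \<not> blue_tight_set E W"
  obtains x y where "x \<in> {a, b, c}" "y \<in> {a, b, c}" "x \<noteq> y"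
    "\<And>W. \<lbrakk>x \<in> W; y \<in> W\<rbrakk> \<Longrightarrow> \<not> tight_set E W \<and> \<not> blue_tight_set E W"
proof (rule ccontr)
  assume "\<not> thesis"
  then have ex: "\<exists>W. x \<in> W \<and> y \<in> W \<and> (tight_set E W \<or> blue_tight_set E W)"
    if "x \<in> {a, b, c}" "y \<in> {a, b, c}" "x \<noteq> y" for x y
    using that \<open>\<And>y x. \<lbrakk>x \<in> {a, b, c}; y \<in> {a, b, c}; x \<noteq> y; \<And>W. \<lbrakk>x \<in> W; y \<in> W\<rbrakk> \<Longrightarrow> \<not> tight_set E W \<and> \<not> blue_tight_set E W\<rbrakk> \<Longrightarrow> thesis\<close>
    by metis
  obtain X where X: "a \<in> X" "b \<in> X" "tight_set E X \<or> blue_tight_set E X"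
    using ex[of a b] dist by blast
  obtain Y where Y: "b \<in> Y" "c \<in> Y" "tight_set E Y \<or> blue_tight_set E Y"
    using ex[of b c] dist by blast
  obtain Z where Z: "a \<in> Z" "c \<in> Z" "tight_set E Z \<or> blue_tight_set E Z"
    using ex[of a c] dist by blast
  have XY: "X \<inter> Y = {b}" "\<not> (tight_set E X \<and> tight_set E Y)"
    using meet_singleton[OF sp none X Y] by blast+
  have YZ: "Y \<inter> Z = {c}" "\<not> (tight_set E Y \<and> tight_set E Z)"
    using meet_singleton[OF sp none _ _ Y(3) _ _ Z(3), of b c a] Y Z by blast+
  have XZ: "X \<inter> Z = {a}" "\<not> (tight_set E X \<and> tight_set E Z)"
    using meet_singleton[OF sp none _ _ X(3) _ _ Z(3), of b a c] X Z by blast+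
  have card: "card X + card Y + card Z = card (X \<union> Y \<union> Z) + 3"
    using card_Un_triangle[OF XY(1) YZ(1) XZ(1)] dist by blast
  have W: "\<not> tight_set E (X \<union> Y \<union> Z)" "\<not> blue_tight_set E (X \<union> Y \<union> Z)"
    using none[of "X \<union> Y \<union> Z"] X Y by blast+
  have two: "2 \<le> card (X \<union> Y \<union> Z)"
    using two_le_cardI[of a "X \<union> Y \<union> Z" b] X dist by blast
  have ne: "X \<union> Y \<union> Z \<noteq> {}" using X by blast
  note count = card_induced_edges_triangle[OF sp _ _ _ XY(1) YZ(1) XZ(1)]
  note B = blue_edges_subset[of E]
  show False
  proof (cases "tight_set E X \<or> tight_set E Y \<or> tight_set E Z")
    case True
    then have "tight_set E (X \<union> Y \<union> Z)"
      using count[of E "blue_edges E" "blue_edges E"] count[of "blue_edges E" E "blue_edges E"]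
        count[of "blue_edges E" "blue_edges E" E] card count_sparseD[OF sp ne]
        X(3) Y(3) Z(3) XY(2) YZ(2) XZ(2) B
      unfolding tight_set_def blue_tight_set_def by auto
    then show False using W by blast
  next
    case False
    then have "blue_tight_set E (X \<union> Y \<union> Z)"
      using card_induced_edges_triangle[OF count_sparse_mono[OF sp B] order_refl order_refl order_refl
          XY(1) YZ(1) XZ(1)] card count_sparse_blueD[OF sp two] X(3) Y(3) Z(3)
      unfolding blue_tight_set_def by auto
    then show False using W by blast
  qed
qed

section \<open>Adding an edge to a sparse set\<close>

lemma card_induced_edges_insert:
  fixes E :: "'v::finite edge set"
  assumes "f \<notin> E"
  shows "card (induced_edges (insert f E) X) = card (induced_edges E X) + (if fst f \<subseteq> X then 1 else 0)"
proof -
  have "induced_edges (insert f E) X =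
      (if fst f \<subseteq> X then insert f (induced_edges E X) else induced_edges E X)"
    by (auto simp: induced_edges_def)
  then show ?thesis
    using assms by (simp add: induced_edges_def)
qed

lemma blue_edges_insert:
  "blue_edges (insert f E) = (if snd f = Blue then insert f (blue_edges E) else blue_edges E)"
  by (auto simp: blue_edges_def)

lemma count_sparse_insertI:
  fixes E :: "'v::finite edge set"
  assumes sp: "count_sparse E" and "({x, y}, k) \<notin> E" and "x \<noteq> y"
    and "\<And>W. \<lbrakk>x \<in> W; y \<in> W\<rbrakk> \<Longrightarrow> \<not> tight_set E W"
    and "\<And>W. \<lbrakk>x \<in> W; y \<in> W; k = Blue\<rbrakk> \<Longrightarrow> \<not> blue_tight_set E W"
  shows "count_sparse (insert ({x, y}, k) E)"
  unfolding count_sparse_def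
proof (intro conjI allI impI)
  fix X :: "'v set" assume "X \<noteq> {}"
  then show "card (induced_edges (insert ({x, y}, k) E) X) + 2 \<le> 2 * card X"
    using assms(4)[of X] count_sparseD[OF sp, of X] 
    by (auto simp: card_induced_edges_insert[OF assms(2)] tight_set_def)
next
  fix X :: "'v set" assume X: "2 \<le> card X"
  have "({x, y}, k) \<notin> blue_edges E"
    using assms(2) by (simp add: blue_edges_def)
  then show "card (induced_edges (blue_edges (insert ({x, y}, k) E)) X) + 3 \<le> 2 * card X"
    using assms(5)[of X] count_sparse_blueD[OF sp X] 
    by (auto simp: card_induced_edges_insert blue_edges_insert blue_tight_set_def)
qed

lemma count_sparse_insert_blue:
  fixes E :: "'v::finite edge set"
  assumes sp: "count_sparse E" and "x \<noteq> y"
    and none: "\<And>W. \<lbrakk>x \<in> W; y \<in> W\<rbrakk> \<Longrightarrow> \<not> tight_set E W \<and> \<not> blue_tight_set E W"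
  shows "({x, y}, Blue) \<notin> E" and "count_sparse (insert ({x, y}, Blue) E)"
proof -
  \<comment> \<open>Otherwise the pair \<open>{x, y}\<close> would itself be blue tight.\<close>
  show new: "({x, y}, Blue) \<notin> E"
  proof
    assume "({x, y}, Blue) \<in> E"
    then have "({x, y}, Blue) \<in> induced_edges (blue_edges E) {x, y}"
      by (simp add: induced_edges_def blue_edges_def)
    then have "card (induced_edges (blue_edges E) {x, y}) > 0"
      by (auto simp: card_gt_0_iff)
    then show False
      using count_sparse_blueD[OF sp, of "{x, y}"] none[of "{x, y}"] assms(2)
      by (simp add: blue_tight_set_def)
  qed
  show "count_sparse (insert ({x, y}, Blue) E)"
    using count_sparse_insertI[OF sp new assms(2)] none by blast
qed

text \<open>If the red edge is already present, the blue one can be added: a blue tight set around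
  both ends would become tight on counting the red edge.\<close>

lemma count_sparse_insert_some:
  fixes E :: "'v::finite edge set"
  assumes sp: "count_sparse E" and "x \<noteq> y"
    and none: "\<And>W. \<lbrakk>x \<in> W; y \<in> W\<rbrakk> \<Longrightarrow> \<not> tight_set E W"
  obtains k where "({x, y}, k) \<notin> E" and "count_sparse (insert ({x, y}, k) E)"
proof (cases "({x, y}, Red) \<in> E")
  case False
  then show ?thesis
    using that[of Red] count_sparse_insertI[OF sp False assms(2)] none by blast
next
  case True
  have "\<not> blue_tight_set E W" if W: "x \<in> W" "y \<in> W" for W
  proof -
    have "insert ({x, y}, Red) (induced_edges (blue_edges E) W) \<subseteq> induced_edges E W"
      using True W by (auto simp: induced_edges_def blue_edges_def)
    then have "card (insert ({x, y}, Red) (induced_edges (blue_edges E) W))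
        \<le> card (induced_edges E W)"
      by (simp add: card_mono)
    moreover have "({x, y}, Red) \<notin> induced_edges (blue_edges E) W"
      by (simp add: induced_edges_def blue_edges_def)
    ultimately show ?thesis
      using none[OF W] count_sparseD[OF sp, of W] W
      unfolding blue_tight_set_def tight_set_def by fastforce
  qed
  then show ?thesis
    using that[of Blue] count_sparse_insert_blue[OF sp assms(2)] none by simp
qed

text \<open>If all degrees were at least 4, double counting would give 4|V| <= 2|E| <= 4|V| -
  4.\<close>

lemma low_degree_vertex:
  fixes E :: "'v::finite edge set"
  assumes "count_sparse E" and "\<And>e. e \<in> E \<Longrightarrow> card (fst e) = 2 \<and> fst e \<subseteq> V" and "V \<noteq> {}"
  obtains v where "v \<in> V" and "card {e \<in> E. v \<in> fst e} \<le> 3"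
proof (rule ccontr)
  assume "\<not> thesis"
  then have deg: "4 \<le> card {e \<in> E. v \<in> fst e}" if "v \<in> V" for v
    using that \<open>\<And>v. \<lbrakk>v \<in> V; card {e \<in> E. v \<in> fst e} \<le> 3\<rbrakk> \<Longrightarrow> thesis\<close> by force
  have "(\<Sum>v\<in>V. 4) \<le> (\<Sum>v\<in>V. card {e \<in> E. v \<in> fst e})"
    using deg by (intro sum_mono) auto
  also have "\<dots> = (\<Sum>v\<in>V. \<Sum>e\<in>E. if v \<in> fst e then 1 else 0)"
    by (simp add: sum.If_cases Int_def)
  also have "\<dots> = (\<Sum>e\<in>E. \<Sum>v\<in>V. if v \<in> fst e then 1 else 0)"
    by (rule sum.swap)
  also have "\<dots> = (\<Sum>e\<in>E. 2)"
  proof (rule sum.cong)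
    fix e assume e: "e \<in> E"
    have "{v \<in> V. v \<in> fst e} = fst e"
      using assms(2)[OF e] by auto
    then show "(\<Sum>v\<in>V. if v \<in> fst e then 1 else 0) = (2::nat)"
      using assms(2)[OF e] by (simp add: sum.If_cases Int_def)
  qed simp
  also have "E = induced_edges E V"
    using assms(2) by (auto simp: induced_edges_def)
  then have "(\<Sum>e\<in>E. 2) = 2 * card (induced_edges E V)"
    by simp
  finally show False
    using count_sparseD[OF assms(1,3)] assms(3) by simp
qed

section \<open>Formal rows of the rigidity matrix\<close>

definition spow :: "real \<Rightarrow> real \<Rightarrow> real" where
  "spow r x = sgn x * \<bar>x\<bar> powr r"

lemma spow_0 [simp]: "spow r 0 = 0"
  by (simp add: spow_def)

lemma spow_eq_0_iff [simp]: "spow r x = 0 \<longleftrightarrow> x = 0"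
  by (simp add: spow_def sgn_zero_iff)

lemma spow_minus [simp]: "spow r (- x) = - spow r x"
  by (simp add: spow_def sgn_minus)

lemma spow_pos: "0 < x \<Longrightarrow> spow r x = x powr r"
  by (simp add: spow_def)

lemma spow_mult: "spow r (x * y) = spow r x * spow r y"
  by (simp add: spow_def sgn_mult abs_mult powr_mult)

lemma abs_spow: "\<bar>spow r x\<bar> = \<bar>x\<bar> powr r"
  by (cases "x = 0") (simp_all add: spow_def abs_mult)

lemma spow_inject:
  assumes "r \<noteq> 0"
  shows "spow r x = spow r y \<longleftrightarrow> x = y"
proof
  assume eq: "spow r x = spow r y"
  have sgn: "sgn (spow r z) = sgn z" for z
    by (auto simp: spow_def sgn_mult sgn_if)
  have abs: "\<bar>spow r z\<bar> powr (1 / r) = \<bar>z\<bar>" for z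
    using assms by (cases "z = 0") (simp_all add: abs_spow powr_powr)
  show "x = y"
    using eq sgn[of x] sgn[of y] abs[of x] abs[of y] by (metis mult_sgn_abs)
qed simp

lemma tendsto_spow:
  assumes "0 < r" and f: "(f \<longlongrightarrow> x) F"
  shows "((\<lambda>t. spow r (f t)) \<longlongrightarrow> spow r x) F"
proof (cases "x = 0")
  \<comment> \<open>The sign is discontinuous at 0, but the absolute value tends to 0 since the
    exponent is positive.\<close>
  case True
  have "((\<lambda>t. \<bar>f t\<bar> powr r) \<longlongrightarrow> 0 powr r) F"
    using assms True by (intro tendsto_powr2) (auto intro: tendsto_rabs_zero)
  then have "((\<lambda>t. norm (spow r (f t))) \<longlongrightarrow> 0) F"
    by (simp add: abs_spow)
  then show ?thesis
    using True tendsto_rabs_zero_cancel[of "\<lambda>t. spow r (f t)" F] by simp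
next
  case False
  then show ?thesis
    unfolding spow_def using f
    by (intro tendsto_mult tendsto_sgn tendsto_powr tendsto_rabs tendsto_const) auto
qed

text \<open>After scaling to x + y = 1, the powers of x and y both lie below x and y if 1 < r, and
  both above them if r < 1. For r = q - 1 this is where q = 2 is excluded.\<close>

lemma powr_add_neq:
  fixes s t r :: real
  assumes "0 < s" "0 < t" "r \<noteq> 1"
  shows "(s + t) powr r \<noteq> s powr r + t powr r"
proof -
  define x where "x = s / (s + t)"
  define y where "y = t / (s + t)"
  have xy: "0 < x" "x < 1" "0 < y" "y < 1" "x + y = 1"
    using assms by (simp_all add: x_def y_def add_divide_distrib[symmetric])
  have "x powr r + y powr r \<noteq> 1"
  proof (cases "1 < r")
    case True
    then have "x powr r < x powr 1" "y powr r < y powr 1"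
      using xy powr_less_mono' by blast+
    then show ?thesis using xy by simp
  next
    case False
    then have "x powr 1 < x powr r" "y powr 1 < y powr r"
      using xy assms(3) powr_less_mono'[of x r 1] powr_less_mono'[of y r 1] by simp_all
    then show ?thesis using xy by simp
  qed
  moreover have "s powr r = x powr r * (s + t) powr r" "t powr r = y powr r * (s + t) powr r"
    using assms by (simp_all add: x_def y_def powr_divide)
  moreover have "(s + t) powr r \<noteq> 0"
    using assms by simp
  ultimately show ?thesis
    by (metis distrib_right mult_cancel_right2)
qed

lemma spow_add_neq:
  assumes r: "r \<noteq> 1" and "s \<noteq> 0" "t \<noteq> 0" "s + t \<noteq> 0"
  shows "spow r (s + t) \<noteq> spow r s + spow r t"
proof -
  have pos: "spow r (x + y) \<noteq> spow r x + spow r y" if "0 < x" "0 < y" for x y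
    using powr_add_neq[OF that r] that by (simp add: spow_pos)
  \<comment> \<open>Moving a negative term to the other side turns each sign pattern into a sum of
    two positive numbers.\<close>
  consider "0 < s" "0 < t" | "s < 0" "t < 0" | "0 < s + t" "t < 0" | "0 < s + t" "s < 0"
    | "s + t < 0" "0 < t" | "s + t < 0" "0 < s"
    using assms(2-4) by linarith
  then show ?thesis
  proof cases
    case 1 then show ?thesis using pos[of s t] by simp
  next
    case 2 then show ?thesis using pos[of "- s" "- t"] spow_minus[of r "s + t"] by simp
  next
    case 3 then show ?thesis using pos[of "s + t" "- t"] by simp
  next
    case 4 then show ?thesis using pos[of "s + t" "- s"] by simp
  next
    case 5 then show ?thesis using pos[of "- (s + t)" "t"] spow_minus[of r "s + t"] by simp
  next
    case 6 then show ?thesis using pos[of "- (s + t)" "s"] spow_minus[of r "s + t"] by simp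
  qed
qed

section \<open>Constraint normals and the rows they define\<close>

fun constraint_normal :: "real \<Rightarrow> colour \<Rightarrow> real^2 \<Rightarrow> real^2" where
  "constraint_normal q Red d = vector [spow (q - 1) (d $ 1), spow (q - 1) (d $ 2)]"
| "constraint_normal q Blue d = vector [- d $ 2, d $ 1]"

lemma vec2_eq_iff: "x = y \<longleftrightarrow> x $ 1 = y $ 1 \<and> x $ 2 = y $ 2" for x y :: "'a^2"
  by (simp add: vec_eq_iff forall_2)

lemma inner_vec2: "x \<bullet> y = x $ 1 * y $ 1 + x $ 2 * y $ 2" for x y :: "real^2"
  by (simp add: inner_vec_def sum_2)

lemma constraint_normal_0 [simp]: "constraint_normal q k 0 = 0"
  by (cases k) (simp_all add: vec2_eq_iff)

lemma constraint_normal_minus [simp]: "constraint_normal q k (- d) = - constraint_normal q k d"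
  by (cases k) (simp_all add: vec2_eq_iff)

lemma constraint_normal_nonzero:
  assumes "d $ 1 \<noteq> 0" "d $ 2 \<noteq> 0"
  shows "constraint_normal q k d $ 1 \<noteq> 0" "constraint_normal q k d $ 2 \<noteq> 0"
  using assms by (cases k; simp)+

text \<open>Normals keep their direction while a joint shrinks towards a neighbour, so that the
  vanishing row can be rescaled.\<close>

lemma constraint_normal_scale:
  assumes "0 < s"
  obtains c where "c \<noteq> 0" "constraint_normal q k (s *\<^sub>R d) = c *\<^sub>R constraint_normal q k d"
proof (cases k)
  case Red
  then show ?thesis
    using assms by (intro that[of "spow (q - 1) s"]) (simp_all add: vec2_eq_iff spow_mult)
next
  case Blue
  then show ?thesis
    using assms by (intro that[of s]) (simp_all add: vec2_eq_iff)
qed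

text \<open>For red, the two products are signed powers of \<open>d $ 1 * e $ 2\<close> and
  \<open>d $ 2 * e $ 1\<close>, and the signed power is injective.\<close>

lemma constraint_normal_noncollinear:
  assumes q: "q \<noteq> 1" and "d $ 1 * e $ 2 \<noteq> d $ 2 * e $ 1"
  shows "constraint_normal q k d $ 1 * constraint_normal q k e $ 2
     \<noteq> constraint_normal q k d $ 2 * constraint_normal q k e $ 1"
proof (cases k)
  case Red
  then show ?thesis
    using assms spow_inject[of "q - 1"] by (simp add: spow_mult[symmetric])
next
  case Blue
  then show ?thesis using assms by (auto simp: mult.commute)
qed

lemma tendsto_constraint_normal:
  assumes "1 < q" and f: "(f \<longlongrightarrow> x) F"
  shows "((\<lambda>t. constraint_normal q k (f t)) \<longlongrightarrow> constraint_normal q k x) F"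
proof (rule vec_tendstoI)
  fix i :: 2
  have "((\<lambda>t. f t $ j) \<longlongrightarrow> x $ j) F" for j
    using f by (rule tendsto_vec_nth)
  then show "((\<lambda>t. constraint_normal q k (f t) $ i) \<longlongrightarrow> constraint_normal q k x $ i) F"
    using assms(1) exhaust_2[of i]
    by (cases k) (auto intro!: tendsto_spow tendsto_minus)
qed

definition pair_row :: "real^2 \<Rightarrow> 'v::finite \<Rightarrow> 'v \<Rightarrow> real^('v \<times> 2)" where
  "pair_row d v w = (\<chi> j. (if fst j = v then d $ snd j else 0) - (if fst j = w then d $ snd j else 0))"

lemma inner_vec_prod2:
  fixes z u :: "real^('v::finite \<times> 2)"
  shows "z \<bullet> u = (\<Sum>x\<in>UNIV. joints z x \<bullet> joints u x)"
  by (simp add: inner_vec_def joints_def UNIV_Times_UNIV[symmetric] sum.cartesian_product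
      del: UNIV_Times_UNIV)

lemma joints_pair_row:
  "joints (pair_row d v w) x = (if x = v then d else 0) - (if x = w then d else 0)"
  by (auto simp: joints_def pair_row_def vec_eq_iff)

lemma inner_pair_row: "pair_row d v w \<bullet> u = d \<bullet> (joints u v - joints u w)"
  by (simp add: inner_vec_prod2 joints_pair_row inner_diff_left inner_diff_right sum_subtractf
      if_distrib[of "\<lambda>y. y \<bullet> _"] cong: if_cong)

lemma pair_row_scale: "pair_row (c *\<^sub>R d) v w = c *\<^sub>R pair_row d v w"
  by (auto simp: pair_row_def vec_eq_iff algebra_simps)

text \<open>An edge is an unordered pair, so neither end can be singled out. The sum runs over both
  ends; a joint paired with itself contributes the normal of 0, which is 0.\<close>

definition edge_row :: "real \<Rightarrow> ('v::finite \<Rightarrow> real^2) \<Rightarrow> 'v edge \<Rightarrow> real^('v \<times> 2)" where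
  "edge_row q p e = (\<chi> j. if fst j \<in> fst e
     then \<Sum>y\<in>fst e. constraint_normal q (snd e) (p (fst j) - p y) $ snd j else 0)"

lemma edge_row_pair:
  assumes "v \<noteq> w"
  shows "edge_row q p ({v, w}, k) = pair_row (constraint_normal q k (p v - p w)) v w"
proof -
  have "constraint_normal q k (p w - p v) = - constraint_normal q k (p v - p w)"
    using constraint_normal_minus[of q k "p v - p w"] by simp
  then show ?thesis
    using assms by (auto simp: edge_row_def pair_row_def vec_eq_iff)
qed

lemma edge_row_cong:
  assumes "\<And>x. x \<in> fst e \<Longrightarrow> p x = p' x"
  shows "edge_row q p e = edge_row q p' e"
proof -
  have "(\<Sum>y\<in>fst e. constraint_normal q (snd e) (p x - p y) $ i) =
      (\<Sum>y\<in>fst e. constraint_normal q (snd e) (p' x - p' y) $ i)" if "x \<in> fst e" for x i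
    using that assms by (intro sum.cong) simp_all
  then show ?thesis
    by (simp add: edge_row_def cong: if_cong)
qed

lemma joints_edge_row_not_incident: "x \<notin> fst e \<Longrightarrow> joints (edge_row q p e) x = 0"
  by (simp add: joints_def edge_row_def vec_eq_iff)

lemma tendsto_edge_row:
  assumes "1 < q" and "\<And>x. ((\<lambda>t. p t x) \<longlongrightarrow> p0 x) F"
  shows "((\<lambda>t. edge_row q (p t) e) \<longlongrightarrow> edge_row q p0 e) F"
proof (rule vec_tendstoI)
  fix j :: "'a \<times> 2"
  have "((\<lambda>t. constraint_normal q (snd e) (p t (fst j) - p t y) $ snd j)
      \<longlongrightarrow> constraint_normal q (snd e) (p0 (fst j) - p0 y) $ snd j) F" for y
    by (intro tendsto_vec_nth tendsto_constraint_normal[OF assms(1)] tendsto_diff assms(2))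
  then show "((\<lambda>t. edge_row q (p t) e $ j) \<longlongrightarrow> edge_row q p0 e $ j) F"
    by (auto simp: edge_row_def intro!: tendsto_sum)
qed

text \<open>Distinct first coordinates give a placement, distinct second coordinates keep the
  scalars of blue rows nonzero, and noncollinearity makes the normals from one joint to two others
  independent.\<close>

definition general_position :: "('v \<Rightarrow> real^2) \<Rightarrow> bool" where
  "general_position p \<longleftrightarrow>
     (\<forall>x y. x \<noteq> y \<longrightarrow> p x $ 1 \<noteq> p y $ 1 \<and> p x $ 2 \<noteq> p y $ 2) \<and>
     (\<forall>x y z. x \<noteq> y \<and> y \<noteq> z \<and> x \<noteq> z \<longrightarrow>
        (p x - p y) $ 1 * (p x - p z) $ 2 \<noteq> (p x - p y) $ 2 * (p x - p z) $ 1)"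

lemma eventually_quadratic_nonzero:
  fixes a b c :: real
  assumes "a \<noteq> 0 \<or> b \<noteq> 0 \<or> c \<noteq> 0"
  shows "\<forall>\<^sub>F t in at_right 0. a + b * t + c * t\<^sup>2 \<noteq> 0"
proof (cases "a = 0")
  case False
  have "((\<lambda>t. a + b * t + c * t\<^sup>2) \<longlongrightarrow> a + b * 0 + c * 0\<^sup>2) (at_right 0)"
    by (intro tendsto_intros)
  then show ?thesis
    using False by (intro tendsto_imp_eventually_ne[of _ a]) auto
next
  case a: True
  have pos: "\<forall>\<^sub>F t in at_right 0. 0 < (t::real)"
    by (simp add: eventually_at_right_less)
  show ?thesis
  proof (cases "b = 0")
    case True
    then show ?thesis
      using pos assms a by (auto elim!: eventually_mono)
  next
    case False
    have "((\<lambda>t. b + c * t) \<longlongrightarrow> b + c * 0) (at_right 0)"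
      by (intro tendsto_intros)
    then have "\<forall>\<^sub>F t in at_right 0. b + c * t \<noteq> 0"
      using False by (intro tendsto_imp_eventually_ne[of _ b]) auto
    with pos show ?thesis
    proof eventually_elim
      case (elim t)
      then have "t * (b + c * t) \<noteq> 0" by simp
      then show ?case using a by (simp add: algebra_simps power2_eq_square)
    qed
  qed
qed

text \<open>Independence survives a small motion, and along the chosen motion each forbidden
  coincidence is a root of a polynomial of degree 1 or 2 in \<open>t\<close> with nonzero leading
  coefficient.\<close>

lemma indep_family_general_position:
  fixes E :: "'v::finite edge set"
  assumes q: "1 < q" and ind: "indep_family (edge_row q p) E"
  obtains p' where "indep_family (edge_row q p') E" and "general_position p'"
proof -
  obtain g :: "'v \<Rightarrow> nat" where g: "inj g"
    using finite_imp_inj_to_nat_seg[of "UNIV :: 'v set"] by auto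
  \<comment> \<open>Positive parameters have distinct squares too.\<close>
  define h where "h x = 1 + real (g x)" for x
  have h: "h x \<noteq> h y" "(h x)\<^sup>2 \<noteq> (h y)\<^sup>2" if "x \<noteq> y" for x y
    using g that by (auto simp: h_def inj_def power2_eq_iff)
  \<comment> \<open>on the moment curve no three points are collinear and no two share a coordinate\<close>
  define P where "P t x = p x + t *\<^sub>R vector [h x, (h x)\<^sup>2]" for t x
  have "\<forall>\<^sub>F t in at_right 0. indep_family (edge_row q (P t)) E"
  proof (rule eventually_indep_family[OF _ ind])
    fix e
    have "((\<lambda>t. P t x) \<longlongrightarrow> p x + 0 *\<^sub>R vector [h x, (h x)\<^sup>2]) (at_right 0)" for x
      unfolding P_def by (intro tendsto_intros)
    then show "((\<lambda>t. edge_row q (P t) e) \<longlongrightarrow> edge_row q p e) (at_right 0)"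
      by (intro tendsto_edge_row[OF q]) simp
  qed
  moreover have "\<forall>\<^sub>F t in at_right 0. \<forall>x y. x \<noteq> y \<longrightarrow> P t x $ 1 \<noteq> P t y $ 1"
  proof (intro eventually_all_finite)
    fix x y
    show "\<forall>\<^sub>F t in at_right 0. x \<noteq> y \<longrightarrow> P t x $ 1 \<noteq> P t y $ 1"
    proof (cases "x = y")
      case False
      have "\<forall>\<^sub>F t in at_right 0. (p x - p y) $ 1 + (h x - h y) * t + 0 * t\<^sup>2 \<noteq> 0"
        by (intro eventually_quadratic_nonzero) (use h False in auto)
      then show ?thesis
        by eventually_elim (simp add: P_def algebra_simps)
    qed simp
  qed
  moreover have "\<forall>\<^sub>F t in at_right 0. \<forall>x y. x \<noteq> y \<longrightarrow> P t x $ 2 \<noteq> P t y $ 2"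
  proof (intro eventually_all_finite)
    fix x y
    show "\<forall>\<^sub>F t in at_right 0. x \<noteq> y \<longrightarrow> P t x $ 2 \<noteq> P t y $ 2"
    proof (cases "x = y")
      case False
      have "\<forall>\<^sub>F t in at_right 0. (p x - p y) $ 2 + ((h x)\<^sup>2 - (h y)\<^sup>2) * t + 0 * t\<^sup>2 \<noteq> 0"
        by (intro eventually_quadratic_nonzero) (use h False in auto)
      then show ?thesis
        by eventually_elim (simp add: P_def algebra_simps)
    qed simp
  qed
  moreover have "\<forall>\<^sub>F t in at_right 0. \<forall>x y z. x \<noteq> y \<and> y \<noteq> z \<and> x \<noteq> z \<longrightarrow>
      (P t x - P t y) $ 1 * (P t x - P t z) $ 2 \<noteq> (P t x - P t y) $ 2 * (P t x - P t z) $ 1"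
  proof (intro eventually_all_finite)
    fix x y z
    show "\<forall>\<^sub>F t in at_right 0. x \<noteq> y \<and> y \<noteq> z \<and> x \<noteq> z \<longrightarrow>
      (P t x - P t y) $ 1 * (P t x - P t z) $ 2 \<noteq> (P t x - P t y) $ 2 * (P t x - P t z) $ 1"
    proof (cases "x \<noteq> y \<and> y \<noteq> z \<and> x \<noteq> z")
      case True
      define y1 y2 z1 z2 where "y1 = (p x - p y) $ 1" and "y2 = (p x - p y) $ 2"
        and "z1 = (p x - p z) $ 1" and "z2 = (p x - p z) $ 2"
      define A B C D where "A = h x - h y" and "B = (h x)\<^sup>2 - (h y)\<^sup>2"
        and "C = h x - h z" and "D = (h x)\<^sup>2 - (h z)\<^sup>2"
      \<comment> \<open>A Vandermonde determinant in the three parameters.\<close>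
      have "A * D - B * C = (h x - h y) * (h x - h z) * (h z - h y)"
        unfolding A_def B_def C_def D_def by algebra
      then have "A * D - B * C \<noteq> 0"
        using h True by auto
      then have "\<forall>\<^sub>F t in at_right 0. (y1 * z2 - y2 * z1) + (y1 * D + A * z2 - y2 * C - B * z1) * t
          + (A * D - B * C) * t\<^sup>2 \<noteq> 0"
        by (intro eventually_quadratic_nonzero) simp
      then show ?thesis
      proof eventually_elim
        case (elim t)
        have diff: "(P t x - P t y) $ 1 = y1 + t * A" "(P t x - P t y) $ 2 = y2 + t * B"
          "(P t x - P t z) $ 1 = z1 + t * C" "(P t x - P t z) $ 2 = z2 + t * D"
          by (simp_all add: P_def y1_def y2_def z1_def z2_def A_def B_def C_def D_def algebra_simps)
        then show ?case
          using elim unfolding diff by (simp add: algebra_simps power2_eq_square)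
      qed
    qed auto
  qed
  ultimately have "\<forall>\<^sub>F t in at_right 0. indep_family (edge_row q (P t)) E \<and> general_position (P t)"
    by eventually_elim (auto simp: general_position_def)
  then show ?thesis
    using eventually_happens'[OF trivial_limit_at_right_real] that by blast
qed

section \<open>Adding a vertex of degree at most three\<close>

lemma joints_sum: "joints (\<Sum>e\<in>S. f e) x = (\<Sum>e\<in>S. joints (f e) x)"
  by (simp add: joints_def vec_eq_iff)

lemma joints_scaleR: "joints (c *\<^sub>R z) x = c *\<^sub>R joints z x"
  by (simp add: joints_def vec_eq_iff)

lemma joints_add: "joints (y + z) x = joints y x + joints z x"
  by (simp add: joints_def vec_eq_iff)

text \<open>A relation is tested twice: its part at \<open>v\<close> involves only the normals
  \<open>d\<close>, and pairing it with the flex \<open>u\<close> removes all rows of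
  \<open>E\<close>. By \<open>det\<close> these conditions kill the coefficients of the star, and
  independence of \<open>E\<close> kills the others.\<close>

lemma indep_family_star:
  fixes E S :: "'v::finite edge set" and r :: "'v edge \<Rightarrow> real^('v \<times> 2)"
  assumes E: "indep_family r E" and disj: "E \<inter> S = {}"
    and joint: "\<And>e. e \<in> E \<Longrightarrow> joints (r e) v = 0"
    and flex: "\<And>e. e \<in> E \<Longrightarrow> r e \<bullet> u = 0"
    and star: "\<And>e. e \<in> S \<Longrightarrow> r e = pair_row (d e) v (w e) \<and> w e \<noteq> v"
    and det: "\<And>c. \<lbrakk>(\<Sum>e\<in>S. c e *\<^sub>R d e) = 0; (\<Sum>e\<in>S. c e * (d e \<bullet> joints u (w e))) = 0\<rbrakk>
      \<Longrightarrow> \<forall>e\<in>S. c e = 0"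
  shows "indep_family r (E \<union> S)"
  unfolding indep_family_iff[OF finite]
proof (intro allI impI)
  fix c assume "(\<Sum>e\<in>E \<union> S. c e *\<^sub>R r e) = 0"
  then have rel: "(\<Sum>e\<in>E. c e *\<^sub>R r e) + (\<Sum>e\<in>S. c e *\<^sub>R r e) = 0"
    using disj by (simp add: sum.union_disjoint)
  have "joints (r e) v = d e" if "e \<in> S" for e
    using star[OF that] by (auto simp: joints_pair_row)
  then have "joints ((\<Sum>e\<in>E. c e *\<^sub>R r e) + (\<Sum>e\<in>S. c e *\<^sub>R r e)) v = (\<Sum>e\<in>S. c e *\<^sub>R d e)"
    using joint by (simp add: joints_add joints_sum joints_scaleR)
  then have 1: "(\<Sum>e\<in>S. c e *\<^sub>R d e) = 0"
    unfolding rel by (simp add: joints_def vec_eq_iff)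
  have "((\<Sum>e\<in>E. c e *\<^sub>R r e) + (\<Sum>e\<in>S. c e *\<^sub>R r e)) \<bullet> u =
      (\<Sum>e\<in>S. c e * (d e \<bullet> (joints u v - joints u (w e))))"
    using flex star by (simp add: inner_add_left inner_sum_left inner_pair_row)
  also have "\<dots> = (\<Sum>e\<in>S. c e *\<^sub>R d e) \<bullet> joints u v - (\<Sum>e\<in>S. c e * (d e \<bullet> joints u (w e)))"
    by (simp add: inner_sum_left inner_diff_right right_diff_distrib sum_subtractf)
  finally have "(\<Sum>e\<in>S. c e * (d e \<bullet> joints u (w e))) = 0"
    unfolding rel 1 by simp
  with det 1 have S: "\<forall>e\<in>S. c e = 0" by blast
  then have "(\<Sum>e\<in>E. c e *\<^sub>R r e) = 0"
    using rel by simp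
  then show "\<forall>e\<in>E \<union> S. c e = 0"
    using E S indep_family_iff[of E r] by auto
qed

text \<open>The determinant with columns (d, s), (e, t), (f, r), expanded along the first
  coordinates.\<close>

definition det_rows :: "real^2 \<Rightarrow> real \<Rightarrow> real^2 \<Rightarrow> real \<Rightarrow> real^2 \<Rightarrow> real \<Rightarrow> real" where
  "det_rows d s e t f r =
     d $ 1 * (e $ 2 * r - t * f $ 2) - e $ 1 * (d $ 2 * r - s * f $ 2) + f $ 1 * (d $ 2 * t - s * e $ 2)"

text \<open>Subtracting \<open>z\<close> from all velocities adds multiples of the first two rows of
  the determinant to the third. Taking for \<open>z\<close> the velocity of a neighbour makes one
  entry zero.\<close>

lemma indep_family_star3:
  fixes E :: "'v::finite edge set" and r :: "'v edge \<Rightarrow> real^('v \<times> 2)"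
  assumes "indep_family r E" and "E \<inter> {e1, e2, e3} = {}"
    and dist: "e1 \<noteq> e2" "e2 \<noteq> e3" "e1 \<noteq> e3"
    and "\<And>e. e \<in> E \<Longrightarrow> joints (r e) v = 0"
    and "\<And>e. e \<in> E \<Longrightarrow> r e \<bullet> u = 0"
    and rows: "r e1 = pair_row d1 v w1" "r e2 = pair_row d2 v w2" "r e3 = pair_row d3 v w3"
    and ne: "w1 \<noteq> v" "w2 \<noteq> v" "w3 \<noteq> v"
    and det: "det_rows d1 (d1 \<bullet> (joints u w1 - z)) d2 (d2 \<bullet> (joints u w2 - z))
      d3 (d3 \<bullet> (joints u w3 - z)) \<noteq> 0"
  shows "indep_family r (E \<union> {e1, e2, e3})"
proof -
  define d where "d e = (if e = e1 then d1 else if e = e2 then d2 else d3)" for e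
  define w where "w e = (if e = e1 then w1 else if e = e2 then w2 else w3)" for e
  have dw [simp]: "d e1 = d1" "d e2 = d2" "d e3 = d3" "w e1 = w1" "w e2 = w2" "w e3 = w3"
    using dist by (auto simp: d_def w_def)
  show ?thesis
  proof (rule indep_family_star[where d = d and w = w and u = u and v = v])
    show "r e = pair_row (d e) v (w e) \<and> w e \<noteq> v" if "e \<in> {e1, e2, e3}" for e
      using that rows ne by auto
    fix c assume "(\<Sum>e\<in>{e1, e2, e3}. c e *\<^sub>R d e) = 0"
      and "(\<Sum>e\<in>{e1, e2, e3}. c e * (d e \<bullet> joints u (w e))) = 0"
    then have eq: "c e1 *\<^sub>R d1 + c e2 *\<^sub>R d2 + c e3 *\<^sub>R d3 = 0"
      and "c e1 * (d1 \<bullet> joints u w1) + c e2 * (d2 \<bullet> joints u w2) + c e3 * (d3 \<bullet> joints u w3) = 0"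
      using dist by (simp_all add: add.assoc)
    moreover have "c e1 * (d1 \<bullet> z) + c e2 * (d2 \<bullet> z) + c e3 * (d3 \<bullet> z) = 0"
      using arg_cong[OF eq, of "\<lambda>y. y \<bullet> z"] by (simp add: inner_add_left)
    ultimately have 3: "c e1 * (d1 \<bullet> (joints u w1 - z)) + c e2 * (d2 \<bullet> (joints u w2 - z))
        + c e3 * (d3 \<bullet> (joints u w3 - z)) = 0"
      unfolding inner_diff_right right_diff_distrib by linarith
    have "c e1 * d1 $ 1 + c e2 * d2 $ 1 + c e3 * d3 $ 1 = 0"
      and "c e1 * d1 $ 2 + c e2 * d2 $ 2 + c e3 * d3 $ 2 = 0"
      using eq by (simp_all add: vec2_eq_iff)
    then have "c e1 = 0 \<and> c e2 = 0 \<and> c e3 = 0"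
      using det unfolding det_rows_def by (rule det3_nonzero_imp_zero[OF _ _ 3])
    then show "\<forall>e\<in>{e1, e2, e3}. c e = 0" by simp
  qed (use assms in auto)
qed

lemma indep_family_star_position:
  fixes E :: "'v::finite edge set"
  assumes ind: "indep_family (edge_row q p) E"
    and E: "\<And>e. e \<in> E \<Longrightarrow> v \<notin> fst e \<and> edge_row q p e \<bullet> u = 0"
    and dist: "(w1, k1) \<noteq> (w2, k2)" "(w2, k2) \<noteq> (w3, k3)" "(w1, k1) \<noteq> (w3, k3)"
    and ne: "w1 \<noteq> v" "w2 \<noteq> v" "w3 \<noteq> v"
    and d: "d1 = constraint_normal q k1 (x - p w1)" "d2 = constraint_normal q k2 (x - p w2)"
      "d3 = constraint_normal q k3 (x - p w3)"
    and det: "det_rows d1 (d1 \<bullet> (joints u w1 - z)) d2 (d2 \<bullet> (joints u w2 - z))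
      d3 (d3 \<bullet> (joints u w3 - z)) \<noteq> 0"
  shows "indep_family (edge_row q (p(v := x))) (E \<union> {({v, w1}, k1), ({v, w2}, k2), ({v, w3}, k3)})"
proof -
  have cong: "edge_row q (p(v := x)) e = edge_row q p e" if "e \<in> E" for e
    using E[OF that] by (intro edge_row_cong) auto
  show ?thesis
    using ne dist
    by (intro indep_family_star3[OF _ _ _ _ _ _ _ _ _ _ _ _ _ det, of _ _ _ _ _ v])
      (auto simp: edge_row_pair d cong E ind indep_family_cong[of E, OF cong] doubleton_eq_iff
        joints_edge_row_not_incident dest: E)
qed

text \<open>The new joint tends to \<open>p a\<close> along \<open>\<delta>\<close>. In the limit
  the row of va, suitably rescaled, keeps the normal of \<open>\<delta>\<close>, while the other two
  edges have the normals they would have from \<open>p a\<close>.\<close>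

lemma indep_family_star_limit:
  fixes E :: "'v::finite edge set"
  assumes q: "1 < q" and ind: "indep_family (edge_row q p) E"
    and E: "\<And>e. e \<in> E \<Longrightarrow> v \<notin> fst e \<and> edge_row q p e \<bullet> u = 0"
    and dist: "a \<noteq> b" "b \<noteq> c" "a \<noteq> c" and ne: "a \<noteq> v" "b \<noteq> v" "c \<noteq> v"
    and d: "d1 = constraint_normal q k1 \<delta>" "d2 = constraint_normal q k2 (p a - p b)"
      "d3 = constraint_normal q k3 (p a - p c)"
    and det: "det_rows d1 (d1 \<bullet> (joints u a - z)) d2 (d2 \<bullet> (joints u b - z))
      d3 (d3 \<bullet> (joints u c - z)) \<noteq> 0"
  obtains p' where
    "indep_family (edge_row q p') (E \<union> {({v, a}, k1), ({v, b}, k2), ({v, c}, k3)})"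
proof -
  define S where "S = E \<union> {({v, a}, k1), ({v, b}, k2), ({v, c}, k3)}"
  define P where "P t = p(v := p a + t *\<^sub>R \<delta>)" for t
  \<comment> \<open>At \<open>t = 0\<close> the true row of va is zero, so its rescaled version is
    carried along instead.\<close>
  define r where "r t e = (if e = ({v, a}, k1) then pair_row d1 v a else edge_row q (P t) e)" for t e
  have cong: "r t e = edge_row q p e" if "e \<in> E" for t e
  proof -
    have "r t e = edge_row q (P t) e"
      using E[OF that] by (auto simp: r_def)
    also have "\<dots> = edge_row q p e"
      using E[OF that] by (intro edge_row_cong) (auto simp: P_def)
    finally show ?thesis .
  qed
  have "indep_family (r 0) S"
    unfolding S_def
  proof (rule indep_family_star3[OF _ _ _ _ _ _ _ _ _ _ _ _ _ det, of _ _ _ _ _ v])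
    show "indep_family (r 0) E"
      using ind indep_family_cong[of E "r 0", OF cong] by blast
    show "joints (r 0 e) v = 0" "r 0 e \<bullet> u = 0" if "e \<in> E" for e
      using E[OF that] cong[OF that] by (simp_all add: joints_edge_row_not_incident)
    show "r 0 ({v, b}, k2) = pair_row d2 v b" "r 0 ({v, c}, k3) = pair_row d3 v c"
      using ne dist by (auto simp: r_def edge_row_pair P_def d doubleton_eq_iff)
    show "E \<inter> {({v, a}, k1), ({v, b}, k2), ({v, c}, k3)} = {}"
      using E[of "({v, a}, k1)"] E[of "({v, b}, k2)"] E[of "({v, c}, k3)"] by auto
  qed (use ne dist in \<open>auto simp: r_def doubleton_eq_iff\<close>)
  moreover have "((\<lambda>t. r t e) \<longlongrightarrow> r 0 e) (at_right 0)" for e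
  proof -
    have "((\<lambda>t. p a + t *\<^sub>R \<delta>) \<longlongrightarrow> p a + 0 *\<^sub>R \<delta>) (at_right 0)"
      by (intro tendsto_intros)
    then have "((\<lambda>t. edge_row q (P t) e) \<longlongrightarrow> edge_row q (P 0) e) (at_right 0)"
      by (intro tendsto_edge_row[OF q]) (simp add: P_def)
    then show ?thesis by (simp add: r_def)
  qed
  ultimately have "\<forall>\<^sub>F t in at_right 0. indep_family (r t) S"
    by (intro eventually_indep_family)
  then have "\<forall>\<^sub>F t in at_right 0. indep_family (r t) S \<and> 0 < t"
    by (simp add: eventually_conj eventually_at_right_less)
  then obtain t where t: "indep_family (r t) S" "0 < t"
    using eventually_happens'[OF trivial_limit_at_right_real] by blast
  obtain s where s: "s \<noteq> 0" "constraint_normal q k1 (t *\<^sub>R \<delta>) = s *\<^sub>R constraint_normal q k1 \<delta>"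
    using constraint_normal_scale[OF t(2)] by blast
  have "indep_family (edge_row q (P t)) S"
  proof (rule indep_family_scale[OF finite t(1)])
    show "edge_row q (P t) e = (if e = ({v, a}, k1) then s else 1) *\<^sub>R r t e" for e
      using ne s by (simp add: r_def edge_row_pair P_def d pair_row_scale)
  qed (use s in auto)
  then show ?thesis
    using that by (simp add: S_def)
qed

section \<open>Positions for the new joint\<close>

lemma two_edge_extension:
  fixes E :: "'v::finite edge set"
  assumes gp: "general_position p" and ind: "indep_family (edge_row q p) E"
    and E: "\<And>e. e \<in> E \<Longrightarrow> v \<notin> fst e"
    and dist: "(a, k) \<noteq> (b, l)" and ne: "a \<noteq> v" "b \<noteq> v"
  obtains p' where "indep_family (edge_row q p') (E \<union> {({v, a}, k), ({v, b}, l)})"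
proof -
  \<comment> \<open>From this point a is seen horizontally, so the normal of va is parallel to an
    axis. If a = b, the colours differ and the two normals lie on different axes. Otherwise x and a
    have first coordinates symmetric about that of b, so both coordinates of the normal at b are
    nonzero.\<close>
  define x :: "real^2" where "x = p a + vector [if a = b then 1 else 2 * (p b $ 1 - p a $ 1), 0]"
  define d where "d e = constraint_normal q (snd e) (x - p (if e = ({v, a}, k) then a else b))" for e
  define w where "w e = (if e = ({v, a}, k) then a else b)" for e
  have new: "({v, b}, l) \<noteq> ({v, a}, k)"
    using dist ne by (auto simp: doubleton_eq_iff)
  have det: "d ({v, a}, k) $ 1 * d ({v, b}, l) $ 2 \<noteq> d ({v, a}, k) $ 2 * d ({v, b}, l) $ 1"
  proof (cases "a = b")
    case True
    then show ?thesis
      using dist new by (cases k; cases l) (simp_all add: d_def x_def)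
  next
    case False
    then have "p a $ 1 \<noteq> p b $ 1" "p a $ 2 \<noteq> p b $ 2"
      using gp by (auto simp: general_position_def)
    then show ?thesis
      using new False constraint_normal_nonzero[of "x - p b" q l]
      by (cases k) (simp_all add: d_def x_def)
  qed
  have cong: "edge_row q (p(v := x)) e = edge_row q p e" if "e \<in> E" for e
    using E[OF that] by (intro edge_row_cong) auto
  have "indep_family (edge_row q (p(v := x))) (E \<union> {({v, a}, k), ({v, b}, l)})"
  proof (rule indep_family_star[where v = v and u = 0 and d = d and w = w])
    show "indep_family (edge_row q (p(v := x))) E"
      using ind indep_family_cong[of E "edge_row q (p(v := x))", OF cong] by blast
    show "edge_row q (p(v := x)) e = pair_row (d e) v (w e) \<and> w e \<noteq> v"
      if "e \<in> {({v, a}, k), ({v, b}, l)}" for e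
      using that ne new by (auto simp: edge_row_pair d_def w_def)
    fix c assume "(\<Sum>e\<in>{({v, a}, k), ({v, b}, l)}. c e *\<^sub>R d e) = 0"
    then have "c ({v, a}, k) *\<^sub>R d ({v, a}, k) + c ({v, b}, l) *\<^sub>R d ({v, b}, l) = 0"
      by (subst (asm) sum.insert) (use new in auto)
    \<comment> \<open>Cramer's rule in two unknowns, padded with a third unknown 0.\<close>
    then have "c ({v, a}, k) * d ({v, a}, k) $ 1 + c ({v, b}, l) * d ({v, b}, l) $ 1 + 0 * 0 = 0"
      "c ({v, a}, k) * d ({v, a}, k) $ 2 + c ({v, b}, l) * d ({v, b}, l) $ 2 + 0 * 0 = 0"
      by (simp_all add: vec2_eq_iff)
    then have "c ({v, a}, k) = 0 \<and> c ({v, b}, l) = 0 \<and> 0 = (0::real)"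
      by (rule det3_nonzero_imp_zero[where ?a3.0 = 0 and ?b3.0 = 0 and ?c3.0 = 1]) (use det in auto)
    then show "\<forall>e\<in>{({v, a}, k), ({v, b}, l)}. c e = 0" by simp
  next
    show "E \<inter> {({v, a}, k), ({v, b}, l)} = {}"
      using E[of "({v, a}, k)"] E[of "({v, b}, l)"] by auto
    show "joints (edge_row q (p(v := x)) e) v = 0" if "e \<in> E" for e
      using E[OF that] by (rule joints_edge_row_not_incident)
  qed auto
  then show ?thesis using that by blast
qed

text \<open>At the corner with the first coordinate of a and the second of c, the red normal at a
  and the blue normal at c are both vertical. These two edges then require \<open>u\<close> to agree
  at a and c in the second coordinate, while the third edge has a normal that is not vertical. The
  opposite corner does the same for the first coordinate, and one of the two must fail.\<close>

lemma corner_extension: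
  fixes E :: "'v::finite edge set"
  assumes gp: "general_position p" and ind: "indep_family (edge_row q p) E"
    and E: "\<And>e. e \<in> E \<Longrightarrow> v \<notin> fst e \<and> edge_row q p e \<bullet> u = 0"
    and ne: "a \<noteq> v" "b \<noteq> v" "c \<noteq> v"
    and dist: "a \<noteq> c" "(b, k) \<noteq> (a, Red)" "(b, k) \<noteq> (c, Blue)"
    and u: "joints u a \<noteq> joints u c"
  obtains p' where
    "indep_family (edge_row q p') (E \<union> {({v, a}, Red), ({v, b}, k), ({v, c}, Blue)})"
proof -
  have inj: "p x $ 1 \<noteq> p y $ 1" "p x $ 2 \<noteq> p y $ 2" if "x \<noteq> y" for x y
    using gp that by (auto simp: general_position_def)
  note star = indep_family_star_position[OF ind E _ _ _ ne refl refl refl,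
      where ?k1.0 = Red and ?k2.0 = k and ?k3.0 = Blue and z = "joints u c"]
  show ?thesis
  proof (cases "joints u a $ 2 = joints u c $ 2")
    case False
    define x :: "real^2" where "x = vector [p a $ 1, p c $ 2]"
    have d2: "constraint_normal q k (x - p b) $ 1 \<noteq> 0"
    proof (cases "b = a \<or> b = c")
      case True
      then show ?thesis
        using dist inj[of a c] inj[of c a] by (cases k) (auto simp: x_def)
    next
      case False
      then show ?thesis
        using inj[of a b] inj[of c b] by (intro constraint_normal_nonzero) (auto simp: x_def)
    qed
    have "indep_family (edge_row q (p(v := x)))
        (E \<union> {({v, a}, Red), ({v, b}, k), ({v, c}, Blue)})"
      by (rule star) (use dist d2 False inj[of c a] inj[of a c]
          in \<open>auto simp: det_rows_def x_def inner_vec2\<close>)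
    then show ?thesis using that by blast
  next
    case True
    then have u1: "joints u a $ 1 \<noteq> joints u c $ 1"
      using u by (simp add: vec2_eq_iff)
    define x :: "real^2" where "x = vector [p c $ 1, p a $ 2]"
    have d2: "constraint_normal q k (x - p b) $ 2 \<noteq> 0"
    proof (cases "b = a \<or> b = c")
      case True
      then show ?thesis
        using dist inj[of a c] inj[of c a] by (cases k) (auto simp: x_def)
    next
      case False
      then show ?thesis
        using inj[of a b] inj[of c b] by (intro constraint_normal_nonzero) (auto simp: x_def)
    qed
    have "indep_family (edge_row q (p(v := x)))
        (E \<union> {({v, a}, Red), ({v, b}, k), ({v, c}, Blue)})"
      by (rule star) (use dist d2 u1 inj[of c a] inj[of a c]
          in \<open>auto simp: det_rows_def x_def inner_vec2\<close>)
    then show ?thesis using that by blast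
  qed
qed

text \<open>With v close to a, the determinant is a linear form in the normal of va, whose direction
  is free. Both coefficients vanish only if \<open>t *\<^sub>R d = s *\<^sub>R e\<close>, impossible
  since \<open>d\<close> and \<open>e\<close> are independent and \<open>s\<close> is nonzero. So a
  normal along one of the axes will do.\<close>

lemma monochromatic_extension:
  fixes E :: "'v::finite edge set"
  assumes q: "1 < q" and gp: "general_position p" and ind: "indep_family (edge_row q p) E"
    and E: "\<And>e. e \<in> E \<Longrightarrow> v \<notin> fst e \<and> edge_row q p e \<bullet> u = 0"
    and ne: "a \<noteq> v" "b \<noteq> v" "c \<noteq> v" and dist: "a \<noteq> b" "b \<noteq> c" "a \<noteq> c"
    and u: "constraint_normal q k (p a - p b) \<bullet> (joints u a - joints u b) \<noteq> 0"
  obtains p' where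
    "indep_family (edge_row q p') (E \<union> {({v, a}, k), ({v, b}, k), ({v, c}, k)})"
proof -
  define d where "d = constraint_normal q k (p a - p b)"
  define e where "e = constraint_normal q k (p a - p c)"
  define s where "s = d \<bullet> (joints u b - joints u a)"
  define t where "t = e \<bullet> (joints u c - joints u a)"
  have "(p a - p b) $ 1 * (p a - p c) $ 2 \<noteq> (p a - p b) $ 2 * (p a - p c) $ 1"
    using gp dist unfolding general_position_def by blast
  then have de: "d $ 1 * e $ 2 \<noteq> d $ 2 * e $ 1"
    unfolding d_def e_def using q by (intro constraint_normal_noncollinear) auto
  have s: "s \<noteq> 0"
    using u by (simp add: s_def d_def inner_diff_right)
  obtain x :: "real^2" where x: "constraint_normal q k x = vector [1, 0]"
  proof (cases k)
    case Red then show ?thesis by (intro that[of "vector [1, 0]"]) (simp add: spow_def)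
  next
    case Blue then show ?thesis by (intro that[of "vector [0, - 1]"]) simp
  qed
  obtain y :: "real^2" where y: "constraint_normal q k y = vector [0, 1]"
  proof (cases k)
    case Red then show ?thesis by (intro that[of "vector [0, 1]"]) (simp add: spow_def)
  next
    case Blue then show ?thesis by (intro that[of "vector [1, 0]"]) simp
  qed
  note lim = indep_family_star_limit[OF q ind E dist ne refl d_def e_def, where ?k1.0 = k and z = "joints u a"]
  show ?thesis
  proof (cases "d $ 2 * t - s * e $ 2 = 0")
    case False
    then show ?thesis
      by (intro lim[OF _ _ that, of x]) (auto simp: det_rows_def x s_def t_def mult.commute)
  next
    case True
    have "d $ 1 * t - s * e $ 1 \<noteq> 0"
    proof
      assume *: "d $ 1 * t - s * e $ 1 = 0"
      have "s * (d $ 1 * e $ 2 - d $ 2 * e $ 1) = 0"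
        using True * by algebra
      then show False using s de by simp
    qed
    then show ?thesis
      by (intro lim[OF _ _ that, of y]) (auto simp: det_rows_def y s_def t_def mult.commute)
  qed
qed

text \<open>At the corner with the first coordinate of b and the second of a, the edges va and vb
  force the velocity of v: first coordinate from a, second from b. The edge vc then demands
  \<open>X * \<xi> + Y * \<eta> = 0\<close>. As v and b share their first coordinate,
  \<open>bc\<close> contains the same \<open>X\<close>, and eliminating \<open>\<eta>\<close> leaves
  the equation that \<open>neq\<close> denies.\<close>

lemma red_corner_extension:
  fixes E :: "'v::finite edge set"
  assumes gp: "general_position p" and ind: "indep_family (edge_row q p) E"
    and E: "\<And>e. e \<in> E \<Longrightarrow> v \<notin> fst e \<and> edge_row q p e \<bullet> u = 0"
    and ne: "a \<noteq> v" "b \<noteq> v" "c \<noteq> v" and dist: "a \<noteq> b" "b \<noteq> c" "a \<noteq> c"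
    and bc: "constraint_normal q Red (p b - p c) \<bullet> (joints u b - joints u c) = 0"
    and neq: "(joints u a - joints u c) $ 1 * spow (q - 1) ((p b - p c) $ 2)
      \<noteq> (joints u b - joints u c) $ 1 * spow (q - 1) ((p a - p c) $ 2)"
  obtains p' where
    "indep_family (edge_row q p') (E \<union> {({v, a}, Red), ({v, b}, Red), ({v, c}, Red)})"
proof -
  have inj: "p x $ 1 \<noteq> p y $ 1" "p x $ 2 \<noteq> p y $ 2" if "x \<noteq> y" for x y
    using gp that by (auto simp: general_position_def)
  define x :: "real^2" where "x = vector [p b $ 1, p a $ 2]"
  define X Y Y' where "X = spow (q - 1) (p b $ 1 - p c $ 1)" and "Y = spow (q - 1) (p a $ 2 - p c $ 2)"
    and "Y' = spow (q - 1) (p b $ 2 - p c $ 2)"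
  define \<xi> \<eta> \<xi>' where "\<xi> = (joints u a - joints u c) $ 1" and "\<eta> = (joints u b - joints u c) $ 2"
    and "\<xi>' = (joints u b - joints u c) $ 1"
  have "X \<noteq> 0" using inj[of b c] dist by (simp add: X_def)
  moreover have "X * \<xi>' + Y' * \<eta> = 0"
    using bc by (simp add: X_def Y'_def \<xi>'_def \<eta>_def inner_vec2)
  moreover have "\<xi> * Y' \<noteq> \<xi>' * Y"
    using neq by (simp add: \<xi>_def \<xi>'_def Y_def Y'_def)
  moreover have "X * (\<xi> * Y' - \<xi>' * Y) = Y' * (X * \<xi> + Y * \<eta>) - Y * (X * \<xi>' + Y' * \<eta>)"
    by algebra
  ultimately have nz: "X * \<xi> + Y * \<eta> \<noteq> 0"
    by auto
  define \<alpha> \<beta> where "\<alpha> = spow (q - 1) (p b $ 1 - p a $ 1)" and "\<beta> = spow (q - 1) (p a $ 2 - p b $ 2)"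
  have "\<alpha> \<noteq> 0" "\<beta> \<noteq> 0"
    using inj[of a b] dist by (simp_all add: \<alpha>_def \<beta>_def)
  have n: "constraint_normal q Red (x - p a) = vector [\<alpha>, 0]"
    "constraint_normal q Red (x - p b) = vector [0, \<beta>]"
    "constraint_normal q Red (x - p c) = vector [X, Y]"
    by (simp_all add: x_def \<alpha>_def \<beta>_def X_def Y_def)
  have "det_rows (vector [\<alpha>, 0]) (vector [\<alpha>, 0] \<bullet> (joints u a - joints u c))
      (vector [0, \<beta>]) (vector [0, \<beta>] \<bullet> (joints u b - joints u c))
      (vector [X, Y]) (vector [X, Y] \<bullet> (joints u c - joints u c)) = - \<alpha> * \<beta> * (X * \<xi> + Y * \<eta>)"
    by (simp add: det_rows_def inner_vec2 \<xi>_def \<eta>_def algebra_simps)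
  then have "indep_family (edge_row q (p(v := x)))
      (E \<union> {({v, a}, Red), ({v, b}, Red), ({v, c}, Red)})"
    using nz \<open>\<alpha> \<noteq> 0\<close> \<open>\<beta> \<noteq> 0\<close> dist
    by (intro indep_family_star_position[OF ind E _ _ _ ne n[symmetric], where z = "joints u c"]) auto
  then show ?thesis using that by blast
qed

text \<open>If every position fails, \<open>u\<close> respects all three red pairs, and the corners
  make the differences \<open>\<xi>\<close> proportional to the signed powers \<open>Y\<close>. But
  \<open>\<xi>\<close> is additive along a, b, c and \<open>Y\<close> is not, so
  \<open>\<xi>\<close> vanishes; the red pair equations then give \<open>\<eta>\<close> = 0, and
  \<open>u\<close> is constant on the neighbours.\<close>

lemma red_extension:
  fixes E :: "'v::finite edge set"
  assumes q: "1 < q" "q \<noteq> 2" and gp: "general_position p" and ind: "indep_family (edge_row q p) E"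
    and E: "\<And>e. e \<in> E \<Longrightarrow> v \<notin> fst e \<and> edge_row q p e \<bullet> u = 0"
    and ne: "a \<noteq> v" "b \<noteq> v" "c \<noteq> v" and dist: "a \<noteq> b" "b \<noteq> c" "a \<noteq> c"
    and u: "\<not> (joints u a = joints u b \<and> joints u b = joints u c)"
  obtains p' where
    "indep_family (edge_row q p') (E \<union> {({v, a}, Red), ({v, b}, Red), ({v, c}, Red)})"
proof (rule ccontr)
  assume "\<not> thesis"
  then have none: "\<not> indep_family (edge_row q p') (E \<union> {({v, a}, Red), ({v, b}, Red), ({v, c}, Red)})"
    for p'
    using that by blast
  have perm: "{({v, b}, Red), ({v, c}, Red), ({v, a}, Red)} = {({v, a}, Red), ({v, b}, Red), ({v, c}, Red)}"
    "{({v, a}, Red), ({v, c}, Red), ({v, b}, Red)} = {({v, a}, Red), ({v, b}, Red), ({v, c}, Red)}"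
    by auto
  have flex: "constraint_normal q Red (p a - p b) \<bullet> (joints u a - joints u b) = 0"
    "constraint_normal q Red (p b - p c) \<bullet> (joints u b - joints u c) = 0"
    "constraint_normal q Red (p a - p c) \<bullet> (joints u a - joints u c) = 0"
    using monochromatic_extension[OF q(1) gp ind E ne dist, of Red]
      monochromatic_extension[OF q(1) gp ind E ne(2,3,1) dist(2) dist(3)[symmetric] dist(1)[symmetric], of Red]
      monochromatic_extension[OF q(1) gp ind E ne(1,3,2) dist(3) dist(2)[symmetric] dist(1), of Red]
      none unfolding perm by metis+
  define Y where "Y x y = spow (q - 1) ((p x - p y) $ 2)" for x y
  define \<xi> where "\<xi> x y = (joints u x - joints u y) $ 1" for x y
  define \<eta> where "\<eta> x y = (joints u x - joints u y) $ 2" for x y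
  have inj: "p x $ 2 \<noteq> p y $ 2" if "x \<noteq> y" for x y
    using gp that by (auto simp: general_position_def)
  have Y: "Y x y \<noteq> 0" if "x \<noteq> y" for x y
    using inj[OF that] by (simp add: Y_def)
  have anti: "Y y x = - Y x y" "\<xi> y x = - \<xi> x y" for x y
    using spow_minus[of "q - 1" "(p x - p y) $ 2"] by (simp_all add: Y_def \<xi>_def)
  have "\<xi> a c * Y b c = \<xi> b c * Y a c"
    using red_corner_extension[OF gp ind E ne dist flex(2)] none unfolding \<xi>_def Y_def by blast
  moreover have "\<xi> b a * Y c a = \<xi> c a * Y b a"
  proof -
    have "constraint_normal q Red (p c - p a) = - constraint_normal q Red (p a - p c)"
      using constraint_normal_minus[of q Red "p a - p c"] by (simp only: minus_diff_eq)
    then have "constraint_normal q Red (p c - p a) \<bullet> (joints u c - joints u a) = 0"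
      using flex(3) by (simp only: inner_minus_left inner_diff_right)
    then show ?thesis
      using red_corner_extension[OF gp ind E ne(2,3,1) dist(2) dist(3)[symmetric] dist(1)[symmetric]]
        none unfolding \<xi>_def Y_def perm by blast
  qed
  then have "\<xi> a b * Y a c = \<xi> a c * Y a b"
    using anti[of a b] anti[of a c] by simp
  moreover have "\<xi> a c = \<xi> a b + \<xi> b c"
    by (simp add: \<xi>_def)
  moreover have "Y a c \<noteq> Y a b + Y b c"
    using spow_add_neq[of "q - 1" "p a $ 2 - p b $ 2" "p b $ 2 - p c $ 2"] q(2)
      inj[OF dist(1)] inj[OF dist(2)] inj[OF dist(3)] by (simp add: Y_def)
  moreover have "\<xi> a c * (Y a b + Y b c - Y a c) =
      (\<xi> a c * Y b c - \<xi> b c * Y a c) - (\<xi> a b * Y a c - \<xi> a c * Y a b)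
      - (\<xi> a c - \<xi> a b - \<xi> b c) * Y a c"
    by algebra
  ultimately have "\<xi> a c = 0"
    by auto
  then have \<xi>: "\<xi> a b = 0" "\<xi> b c = 0"
    using \<open>\<xi> a b * Y a c = \<xi> a c * Y a b\<close> \<open>\<xi> a c * Y b c = \<xi> b c * Y a c\<close> Y[OF dist(3)] by auto
  have "\<eta> a b = 0" "\<eta> b c = 0"
    using flex(1,2) \<xi> Y[OF dist(1)] Y[OF dist(2)]
    by (auto simp: inner_vec2 \<xi>_def \<eta>_def Y_def)
  then show False
    using \<xi> u by (simp add: vec2_eq_iff \<xi>_def \<eta>_def)
qed

lemma two_coloured_extension:
  fixes E :: "'v::finite edge set"
  assumes gp: "general_position p" and ind: "indep_family (edge_row q p) E"
    and E: "\<And>e. e \<in> E \<Longrightarrow> v \<notin> fst e \<and> edge_row q p e \<bullet> u = 0"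
    and ne: "a \<noteq> v" "b \<noteq> v" "c \<noteq> v"
    and dist: "(b, l) \<noteq> (c, m)" "(a, k) \<noteq> (c, m)"
    and kl: "k \<noteq> l" and u: "joints u a \<noteq> joints u b"
  obtains p' where
    "indep_family (edge_row q p') (E \<union> {({v, a}, k), ({v, b}, l), ({v, c}, m)})"
proof (cases k)
  case Red
  then have l: "l = Blue"
    using kl by (cases l) auto
  obtain p' where
    "indep_family (edge_row q p') (E \<union> {({v, a}, Red), ({v, c}, m), ({v, b}, Blue)})"
    by (rule corner_extension[OF gp ind E ne(1,3,2) _ _ _ u, of m]) (use dist Red l u in auto)
  moreover have "{({v, a}, Red), ({v, c}, m), ({v, b}, Blue)} = {({v, a}, k), ({v, b}, l), ({v, c}, m)}"
    using Red l by auto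
  ultimately show ?thesis using that by metis
next
  case Blue
  then have l: "l = Red"
    using kl by (cases l) auto
  obtain p' where
    "indep_family (edge_row q p') (E \<union> {({v, b}, Red), ({v, c}, m), ({v, a}, Blue)})"
    by (rule corner_extension[OF gp ind E ne(2,3,1) _ _ _ u[symmetric], of m]) (use dist Blue l u in auto)
  moreover have "{({v, b}, Red), ({v, c}, m), ({v, a}, Blue)} = {({v, a}, k), ({v, b}, l), ({v, c}, m)}"
    using Blue l by auto
  ultimately show ?thesis using that by metis
qed

lemma three_edge_extension:
  fixes E :: "'v::finite edge set"
  assumes q: "1 < q" "q \<noteq> 2" and gp: "general_position p" and ind: "indep_family (edge_row q p) E"
    and E: "\<And>e. e \<in> E \<Longrightarrow> v \<notin> fst e \<and> edge_row q p e \<bullet> u = 0"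
    and ne: "a \<noteq> v" "b \<noteq> v" "c \<noteq> v"
    and dist: "(a, k) \<noteq> (b, l)" "(b, l) \<noteq> (c, m)" "(a, k) \<noteq> (c, m)"
    and u: "\<not> (joints u a = joints u b \<and> joints u b = joints u c)"
    and red: "k = Red \<or> l = Red \<or> m = Red"
  obtains p' where
    "indep_family (edge_row q p') (E \<union> {({v, a}, k), ({v, b}, l), ({v, c}, m)})"
proof (cases "k = Red \<and> l = Red \<and> m = Red")
  case True
  then show ?thesis
    using dist u by (intro red_extension[OF q gp ind E ne _ _ _ _ that]) auto
next
  case False
  note ext = two_coloured_extension[OF gp ind E]
  \<comment> \<open>Neither the colours nor the velocities are constant on the three edges. Were
    every pair of differently coloured edges to have equal velocities, all three velocities would
    agree.\<close>
  consider "k \<noteq> l" "joints u a \<noteq> joints u b" | "k \<noteq> m" "joints u a \<noteq> joints u c"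
    | "l \<noteq> m" "joints u b \<noteq> joints u c"
    using u red False by ((cases k; cases l; cases m; simp), metis+)
  then show ?thesis
  proof cases
    case 1
    show ?thesis by (rule ext[OF _ ne dist(2,3) 1 that])
  next
    case 2
    have "{({v, a}, k), ({v, c}, m), ({v, b}, l)} = {({v, a}, k), ({v, b}, l), ({v, c}, m)}"
      by auto
    then show ?thesis
      using ext[OF _ ne(1,3,2) dist(2)[symmetric] dist(1) 2] that by metis
  next
    case 3
    have "{({v, b}, l), ({v, c}, m), ({v, a}, k)} = {({v, a}, k), ({v, b}, l), ({v, c}, m)}"
      by auto
    then show ?thesis
      using ext[OF _ ne(2,3,1) dist(3)[symmetric] dist(1)[symmetric] 3] that by metis
  qed
qed

section \<open>Counts around a vertex of degree three\<close>

lemma untight_pair: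
  fixes E :: "'v::finite edge set"
  assumes sp: "count_sparse E" and ne: "\<not> (a = b \<and> b = c)"
    and none: "\<And>W. \<lbrakk>a \<in> W; b \<in> W; c \<in> W\<rbrakk> \<Longrightarrow> \<not> tight_set E W"
  obtains x y where "x \<in> {a, b, c}" "y \<in> {a, b, c}" "x \<noteq> y"
    "\<And>W. \<lbrakk>x \<in> W; y \<in> W\<rbrakk> \<Longrightarrow> \<not> tight_set E W"
proof (rule ccontr)
  assume "\<not> thesis"
  then have ex: "\<exists>W. x \<in> W \<and> y \<in> W \<and> tight_set E W"
    if "x \<in> {a, b, c}" "y \<in> {a, b, c}" "x \<noteq> y" for x y
    using that \<open>\<And>y x. \<lbrakk>x \<in> {a, b, c}; y \<in> {a, b, c}; x \<noteq> y; \<And>W. \<lbrakk>x \<in> W; y \<in> W\<rbrakk> \<Longrightarrow> \<not> tight_set E W\<rbrakk> \<Longrightarrow> thesis\<close>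
    by metis
  show False
  proof (cases "a = b \<or> b = c")
    case True
    then show False using ex[of a c] ne none by blast
  next
    case False
    obtain X Y where X: "a \<in> X" "b \<in> X" "tight_set E X" and Y: "b \<in> Y" "c \<in> Y" "tight_set E Y"
      using ex[of a b] ex[of b c] False by blast
    then have "tight_set E (X \<union> Y)"
      by (intro tight_set_Un[OF sp]) auto
    then show False using none[of "X \<union> Y"] X Y by blast
  qed
qed

text \<open>Adding v and its three edges to a tight set raises the bound by 2 and the count by 3.
  The set may contain v already; removing it first loses no edge, as the remaining edges avoid
  v.\<close>

lemma not_tight_around_star:
  fixes E :: "'v::finite edge set"
  assumes sp: "count_sparse E" and S: "card {e \<in> E. v \<in> fst e} = 3"
    and W: "\<And>e. \<lbrakk>e \<in> E; v \<in> fst e\<rbrakk> \<Longrightarrow> fst e \<subseteq> insert v W" and ne: "W - {v} \<noteq> {}"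
  shows "\<not> tight_set {e \<in> E. v \<notin> fst e} W"
proof
  assume tight: "tight_set {e \<in> E. v \<notin> fst e} W"
  let ?E = "{e \<in> E. v \<notin> fst e}"
  have ind: "induced_edges ?E W = induced_edges ?E (W - {v})"
    by (auto simp: induced_edges_def)
  have "card (induced_edges ?E W) + 3 = card (induced_edges ?E W \<union> {e \<in> E. v \<in> fst e})"
    unfolding S[symmetric] by (intro card_Un_disjoint[symmetric]) (auto simp: induced_edges_def)
  also have "\<dots> \<le> card (induced_edges E (insert v (W - {v})))"
    unfolding ind using W by (intro card_mono finite) (auto simp: induced_edges_def)
  also have "\<dots> + 2 \<le> 2 * card (insert v (W - {v}))"
    by (intro count_sparseD[OF sp]) simp
  finally have "card (induced_edges ?E W) + 3 + 2 \<le> 2 * (card (W - {v}) + 1)"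
    by (simp del: insert_Diff_single)
  moreover have "card (W - {v}) \<le> card W"
    by (simp add: card_mono)
  ultimately show False
    using tight unfolding tight_set_def by simp
qed

lemma not_blue_tight_around_star:
  fixes E :: "'v::finite edge set"
  assumes sp: "count_sparse E" and S: "card {e \<in> E. v \<in> fst e} = 3"
    and blue: "\<And>e. \<lbrakk>e \<in> E; v \<in> fst e\<rbrakk> \<Longrightarrow> snd e = Blue"
    and W: "\<And>e. \<lbrakk>e \<in> E; v \<in> fst e\<rbrakk> \<Longrightarrow> fst e \<subseteq> insert v W" and ne: "W - {v} \<noteq> {}"
  shows "\<not> blue_tight_set {e \<in> E. v \<notin> fst e} W"
proof
  assume tight: "blue_tight_set {e \<in> E. v \<notin> fst e} W"
  let ?E = "blue_edges {e \<in> E. v \<notin> fst e}"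
  have ind: "induced_edges ?E W = induced_edges ?E (W - {v})"
    by (auto simp: induced_edges_def blue_edges_def)
  have "card (induced_edges ?E W) + 3 = card (induced_edges ?E W \<union> {e \<in> E. v \<in> fst e})"
    unfolding S[symmetric]
    by (intro card_Un_disjoint[symmetric]) (auto simp: induced_edges_def blue_edges_def)
  also have "\<dots> \<le> card (induced_edges (blue_edges E) (insert v (W - {v})))"
    unfolding ind using W blue by (intro card_mono finite) (auto simp: induced_edges_def blue_edges_def)
  finally have "card (induced_edges ?E W) + 3 + 3 \<le> card (induced_edges (blue_edges E) (insert v (W - {v}))) + 3"
    by simp
  also have "\<dots> \<le> 2 * card (insert v (W - {v}))"
    using ne two_le_cardI[of v "insert v (W - {v})"] by (intro count_sparse_blueD[OF sp]) blast
  finally have "card (induced_edges ?E W) + 3 + 3 \<le> 2 * (card (W - {v}) + 1)"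
    by (simp del: insert_Diff_single)
  moreover have "card (W - {v}) \<le> card W"
    by (simp add: card_mono)
  ultimately show False
    using tight unfolding blue_tight_set_def by simp
qed

theorem count_sparse_imp_indep_family:
  fixes E :: "'v::finite edge set"
  assumes q: "1 < q" "q \<noteq> 2" and "count_sparse E" and "\<And>e. e \<in> E \<Longrightarrow> card (fst e) = 2"
  obtains p where "indep_family (edge_row q p) E"
proof -
  \<comment> \<open>The induction is on a set \<open>V\<close> containing all ends, with
    \<open>E\<close> arbitrary, because the smaller instance may contain the added edge f.\<close>
  have "\<exists>p. indep_family (edge_row q p) E"
    if "count_sparse E" "\<And>e. e \<in> E \<Longrightarrow> card (fst e) = 2 \<and> fst e \<subseteq> V" for E and V :: "'v set"
    using finite[of V] that
  proof (induction V arbitrary: E rule: finite_psubset_induct)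
    case (psubset V)
    note sp = psubset.prems(1)
    show ?case
    proof (cases "V = {}")
      case True
      then have "E = {}"
        using psubset.prems(2) by fastforce
      then show ?thesis by (simp add: indep_family_def)
    next
      case False
      then obtain v where v: "v \<in> V" "card {e \<in> E. v \<in> fst e} \<le> 3"
        using low_degree_vertex[OF sp psubset.prems(2)] by blast
      define F where "F = {e \<in> E. v \<notin> fst e}"
      define S where "S = {e \<in> E. v \<in> fst e}"
      have E: "E = F \<union> S" by (auto simp: F_def S_def)
      have F: "count_sparse F" "\<And>e. e \<in> F \<Longrightarrow> card (fst e) = 2 \<and> fst e \<subseteq> V - {v}"
        using count_sparse_mono[OF sp, of F] psubset.prems(2) by (auto simp: F_def)
      have Sv: "\<exists>w. fst e = {v, w} \<and> w \<noteq> v \<and> w \<in> V" if "e \<in> S" for e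
        using psubset.prems(2)[of e] that by (auto simp: S_def card_2_iff)
      \<comment> \<open>The induction hypothesis followed by a perturbation into general
        position.\<close>
      have IH: "\<exists>p. indep_family (edge_row q p) E' \<and> general_position p"
        if "count_sparse E'" "\<And>e. e \<in> E' \<Longrightarrow> card (fst e) = 2 \<and> fst e \<subseteq> V - {v}" for E'
        using psubset.IH[of "V - {v}" E'] v(1) that indep_family_general_position[OF q(1)]
        by (metis Diff_subset DiffD2 psubsetI singletonI)
      consider "S = {}" | e where "S = {e}" | e f where "S = {e, f}" "e \<noteq> f" | "card S = 3"
        using v(2) unfolding S_def[symmetric]
        by (metis One_nat_def card_1_singletonE card_2_iff card_eq_0_iff finite le_SucE le_zero_eq
            numeral_2_eq_2 numeral_3_eq_3)
      then show ?thesis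
      proof cases
        case 1
        then show ?thesis using IH[OF F] E by auto
      next
        case (2 e)
        obtain p where p: "indep_family (edge_row q p) F" "general_position p"
          using IH[OF F] by blast
        obtain w k where e: "e = ({v, w}, k)" "w \<noteq> v"
          using Sv[of e] 2 by (metis insertI1 prod.collapse)
        \<comment> \<open>A parallel edge of the other colour reduces this to degree two; it is
          dropped afterwards.\<close>
        obtain l where "l \<noteq> k"
          by (metis colour.distinct(1))
        then obtain p' where
          "indep_family (edge_row q p') (F \<union> {({v, w}, k), ({v, w}, l)})"
          using two_edge_extension[OF p(2,1), of v w k w l] e by (auto simp: F_def)
        then have "indep_family (edge_row q p') E"
          by (rule indep_family_mono) (auto simp: E 2 e)
        then show ?thesis by blast
      next
        case (3 e f)
        obtain p where p: "indep_family (edge_row q p) F" "general_position p"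
          using IH[OF F] by blast
        obtain a k b l where e: "e = ({v, a}, k)" "a \<noteq> v" and f: "f = ({v, b}, l)" "b \<noteq> v"
          using Sv[of e] Sv[of f] 3 by (metis insertCI prod.collapse)
        then have "(a, k) \<noteq> (b, l)" using 3 by auto
        then obtain p' where
          "indep_family (edge_row q p') (F \<union> {({v, a}, k), ({v, b}, l)})"
          using two_edge_extension[OF p(2,1), of v a k b l] e f by (auto simp: F_def)
        then show ?thesis
          unfolding E 3 e f by blast
      next
        case 4
        then obtain e f g where efg: "S = {e, f, g}" "e \<noteq> f" "f \<noteq> g" "e \<noteq> g"
          unfolding card_3_iff by metis
        obtain a k where e: "e = ({v, a}, k)" "a \<noteq> v" "a \<in> V"
          using Sv[of e] efg by (metis insertCI prod.collapse)
        obtain b l where f: "f = ({v, b}, l)" "b \<noteq> v" "b \<in> V"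
          using Sv[of f] efg by (metis insertCI prod.collapse)
        obtain c m where g: "g = ({v, c}, m)" "c \<noteq> v" "c \<in> V"
          using Sv[of g] efg by (metis insertCI prod.collapse)
        have dist: "(a, k) \<noteq> (b, l)" "(b, l) \<noteq> (c, m)" "(a, k) \<noteq> (c, m)"
          using efg e f g by auto
        have fst_star: "fst h \<in> {{v, a}, {v, b}, {v, c}} \<and> snd h \<in> {k, l, m}"
          if "h \<in> E" "v \<in> fst h" for h
        proof -
          have "h \<in> S" using that by (simp add: S_def)
          then show ?thesis unfolding efg(1) e(1) f(1) g(1) by auto
        qed
        have nbrs: "fst h \<subseteq> insert v W"
          if "a \<in> W" "b \<in> W" "c \<in> W" "h \<in> E" "v \<in> fst h" for W h
          using fst_star[OF that(4,5)] that(1-3) by blast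
        have three: "card {e \<in> E. v \<in> fst e} = 3"
          using 4 by (simp add: S_def)
        \<comment> \<open>No tight set contains all three neighbours, so the uncrossing lemmas yield
          a pair that can be joined by f.\<close>
        have loose: "\<not> tight_set F W" if "a \<in> W" "b \<in> W" "c \<in> W" for W
          unfolding F_def using that e(2) nbrs[OF that]
          by (intro not_tight_around_star[OF sp three]) auto
        have FV: "card (fst e) = 2 \<and> fst e \<subseteq> V - {v}"
          if "x \<in> {a, b, c}" "y \<in> {a, b, c}" "x \<noteq> y" "e \<in> insert ({x, y}, r) F" for x y r e
          using that F(2)[of e] e(2,3) f(2,3) g(2,3) by auto
        have flex: "\<exists>p u. general_position p \<and> indep_family (edge_row q p) F \<and>
            (\<forall>e\<in>F. v \<notin> fst e \<and> edge_row q p e \<bullet> u = 0) \<and>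
            constraint_normal q r (p x - p y) \<bullet> (joints u x - joints u y) \<noteq> 0"
          if xy: "x \<in> {a, b, c}" "y \<in> {a, b, c}" "x \<noteq> y"
            and new: "({x, y}, r) \<notin> F" "count_sparse (insert ({x, y}, r) F)" for x y r
        proof -
          obtain p where p: "indep_family (edge_row q p) (insert ({x, y}, r) F)" "general_position p"
            using IH[OF new(2)] FV[OF xy, of _ r] by meson
          then obtain u where "\<And>e. e \<in> F \<Longrightarrow> edge_row q p e \<bullet> u = 0"
            and "edge_row q p ({x, y}, r) \<bullet> u \<noteq> 0"
            using indep_family_insert_obtain[OF p(1) new(1)] by blast
          moreover have "indep_family (edge_row q p) F"
            using p(1) by (rule indep_family_mono) auto
          ultimately show ?thesis
            using p(2) xy(3)
            by (intro exI[of _ p] exI[of _ u]) (auto simp: F_def edge_row_pair inner_pair_row)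
        qed
        have S: "E = F \<union> {({v, a}, k), ({v, b}, l), ({v, c}, m)}"
          unfolding E efg(1) e(1) f(1) g(1) ..
        show ?thesis
        proof (cases "k = Blue \<and> l = Blue \<and> m = Blue")
          case True
          then have abc: "a \<noteq> b" "b \<noteq> c" "a \<noteq> c"
            using dist by auto
          have "snd h = Blue" if "h \<in> E" "v \<in> fst h" for h
            using fst_star[OF that] True by blast
          then have "\<not> blue_tight_set F W" if "a \<in> W" "b \<in> W" "c \<in> W" for W
            unfolding F_def using that e(2) nbrs[OF that]
            by (intro not_blue_tight_around_star[OF sp three]) auto
          then obtain x y where xy: "x \<in> {a, b, c}" "y \<in> {a, b, c}" "x \<noteq> y"
            and none: "\<And>W. \<lbrakk>x \<in> W; y \<in> W\<rbrakk> \<Longrightarrow> \<not> tight_set F W \<and> \<not> blue_tight_set F W"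
            using untight_pair_of_three[OF F(1) abc] loose by metis
          obtain p u where p: "general_position p" "indep_family (edge_row q p) F"
            and u: "\<forall>e\<in>F. v \<notin> fst e \<and> edge_row q p e \<bullet> u = 0"
            and xyu: "constraint_normal q Blue (p x - p y) \<bullet> (joints u x - joints u y) \<noteq> 0"
            using flex[OF xy count_sparse_insert_blue[OF F(1) xy(3) none]] by blast
          have "\<exists>z\<in>{a, b, c}. z \<noteq> x \<and> z \<noteq> y \<and> {x, y, z} = {a, b, c}"
            using xy abc by auto
          then obtain z where z: "z \<noteq> x" "z \<noteq> y" "{x, y, z} = {a, b, c}"
            by blast
          have "v \<notin> {x, y, z}"
            unfolding z(3) using e(2) f(2) g(2) by simp
          then have "x \<noteq> v" "y \<noteq> v" "z \<noteq> v"
            by auto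
          then obtain p' where
            "indep_family (edge_row q p') (F \<union> {({v, x}, Blue), ({v, y}, Blue), ({v, z}, Blue)})"
            using monochromatic_extension[OF q(1) p, of v u x y z Blue] u xyu xy(3) z(1,2) by metis
          \<comment> \<open>In a star of one colour the edges depend only on the set of neighbours,
            so reordering them is harmless.\<close>
          moreover have "(\<lambda>w. ({v, w}, Blue)) ` {x, y, z} = (\<lambda>w. ({v, w}, Blue)) ` {a, b, c}"
            unfolding z(3) ..
          then have "{({v, x}, Blue), ({v, y}, Blue), ({v, z}, Blue)} = {({v, a}, k), ({v, b}, l), ({v, c}, m)}"
            using True by simp
          ultimately show ?thesis
            unfolding S by metis
        next
          case False
          then have red: "k = Red \<or> l = Red \<or> m = Red"
            by (metis colour.exhaust)
          have "\<not> (a = b \<and> b = c)"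
            using dist by (cases k; cases l; cases m) auto
          then obtain x y where xy: "x \<in> {a, b, c}" "y \<in> {a, b, c}" "x \<noteq> y"
            and none: "\<And>W. \<lbrakk>x \<in> W; y \<in> W\<rbrakk> \<Longrightarrow> \<not> tight_set F W"
            using untight_pair[OF F(1)] loose by metis
          obtain r where r: "({x, y}, r) \<notin> F" "count_sparse (insert ({x, y}, r) F)"
            using count_sparse_insert_some[OF F(1) xy(3) none] by blast
          obtain p u where p: "general_position p" "indep_family (edge_row q p) F"
            and u: "\<forall>e\<in>F. v \<notin> fst e \<and> edge_row q p e \<bullet> u = 0"
            and xyu: "constraint_normal q r (p x - p y) \<bullet> (joints u x - joints u y) \<noteq> 0"
            using flex[OF xy r] by blast
          \<comment> \<open>Whatever the colour of f, violating it requires different velocities at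
            its ends.\<close>
          have "joints u x \<noteq> joints u y"
            using xyu by auto
          then have "\<not> (joints u a = joints u b \<and> joints u b = joints u c)"
            using xy by auto
          then obtain p' where
            "indep_family (edge_row q p') (F \<union> {({v, a}, k), ({v, b}, l), ({v, c}, m)})"
            using three_edge_extension[OF q p _ e(2) f(2) g(2) dist _ red, of u] u by metis
          then show ?thesis
            unfolding S by blast
        qed
      qed
    qed
  qed
  from this[of E UNIV] show ?thesis
    using that assms by auto
qed

section \<open>The rigidity matrix\<close>

lemma abs_powr_has_real_derivative:
  assumes "1 < (q::real)"
  shows "((\<lambda>t. \<bar>t\<bar> powr q) has_real_derivative q * spow (q - 1) t) (at t)"
proof -
  consider "t = 0" | "0 < t" | "t < 0" by linarith
  then show ?thesis
  proof cases
    case 1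
    then show ?thesis
      using abs_powr_has_real_derivative_0[OF assms] by simp
  next
    case 2
    have "((\<lambda>s. s powr q) has_real_derivative q * spow (q - 1) t) (at t)"
      using 2 by (auto intro!: derivative_eq_intros simp: spow_pos)
    then show ?thesis
      by (rule has_field_derivative_transform_within_open[where S = "{0<..}"]) (use 2 in auto)
  next
    case 3
    have "((\<lambda>s. (- s) powr q) has_real_derivative q * spow (q - 1) t) (at t)"
      using 3 by (auto intro!: derivative_eq_intros simp: spow_def)
    then show ?thesis
      by (rule has_field_derivative_transform_within_open[where S = "{..<0}"]) (use 3 in auto)
  qed
qed

text \<open>The factor \<open>s\<close> is a positive power for red. For blue it is
  \<open>2 * y / x ^ 3\<close>, the slope having been squared, and it vanishes on a horizontal edge;
  hence the condition on second coordinates.\<close>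

lemma separation_has_derivative:
  fixes p :: "'v::finite \<Rightarrow> real^2"
  assumes q: "1 < q" and ne: "p v $ 1 \<noteq> p w $ 1"
  obtains s where "((\<lambda>z. separation q k (joints z v) (joints z w)) has_derivative
      (\<lambda>h. s * (constraint_normal q k (p v - p w) \<bullet> (joints h v - joints h w)))) (at (coords p))"
    and "p v $ 2 \<noteq> p w $ 2 \<Longrightarrow> s \<noteq> 0"
proof -
  define x where "x z = joints z v $ 1 - joints z w $ 1" for z :: "real^('v \<times> 2)"
  define y where "y z = joints z v $ 2 - joints z w $ 2" for z :: "real^('v \<times> 2)"
  have lin: "(x has_derivative x) (at (coords p))" "(y has_derivative y) (at (coords p))"
    unfolding x_def y_def joints_def vec_lambda_beta
    by (intro bounded_linear_imp_has_derivative bounded_linear_sub bounded_linear_vec_nth)+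
  have xp: "x (coords p) = (p v - p w) $ 1" and yp: "y (coords p) = (p v - p w) $ 2"
    by (simp_all add: x_def y_def joints_def coords_def)
  have x0: "x (coords p) \<noteq> 0"
    using ne xp by simp
  show ?thesis
  proof (cases k)
    case Red
    define D where "D z = \<bar>x z\<bar> powr q + \<bar>y z\<bar> powr q" for z
    have pos: "0 < D (coords p)"
      using x0 by (simp add: D_def add_pos_nonneg)
    have "(D has_derivative (\<lambda>h. x h * (q * spow (q - 1) (x (coords p))) +
        y h * (q * spow (q - 1) (y (coords p))))) (at (coords p))"
      unfolding D_def
      by (intro has_derivative_add DERIV_compose_FDERIV[OF abs_powr_has_real_derivative[OF q]] lin)
    moreover have "((\<lambda>t. t powr (1 / q)) has_real_derivative
        (1 / q) * D (coords p) powr (1 / q - 1)) (at (D (coords p)))"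
      using pos by (auto intro!: derivative_eq_intros)
    ultimately have "((\<lambda>z. D z powr (1 / q)) has_derivative (\<lambda>h.
        (x h * (q * spow (q - 1) (x (coords p))) + y h * (q * spow (q - 1) (y (coords p)))) *
        ((1 / q) * D (coords p) powr (1 / q - 1)))) (at (coords p))"
      by (rule DERIV_compose_FDERIV[rotated])
    also have "(\<lambda>h. (x h * (q * spow (q - 1) (x (coords p))) + y h * (q * spow (q - 1) (y (coords p)))) *
        ((1 / q) * D (coords p) powr (1 / q - 1))) =
        (\<lambda>h. D (coords p) powr (1 / q - 1) *
          (constraint_normal q k (p v - p w) \<bullet> (joints h v - joints h w)))"
      using q unfolding xp yp by (auto simp: fun_eq_iff Red inner_vec2 x_def y_def field_simps)
    also have "(\<lambda>z. D z powr (1 / q)) = (\<lambda>z. separation q k (joints z v) (joints z w))"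
      by (simp add: D_def x_def y_def Red lq_norm_def)
    finally show ?thesis
      using pos by (intro that) auto
  next
    case Blue
    define s where "s = 2 * y (coords p) / x (coords p) ^ 3"
    have "((\<lambda>z. (y z)\<^sup>2 / (x z)\<^sup>2) has_derivative (\<lambda>h. s * (x (coords p) * y h - y (coords p) * x h)))
        (at (coords p))"
      using x0
      by (auto intro!: derivative_eq_intros lin
          simp: s_def fun_eq_iff field_simps power2_eq_square power3_eq_cube)
    also have "(\<lambda>h. s * (x (coords p) * y h - y (coords p) * x h)) =
        (\<lambda>h. s * (constraint_normal q k (p v - p w) \<bullet> (joints h v - joints h w)))"
      unfolding xp yp by (auto simp: fun_eq_iff Blue inner_vec2 x_def y_def algebra_simps)
    also have "(\<lambda>z. (y z)\<^sup>2 / (x z)\<^sup>2) = (\<lambda>z. separation q k (joints z v) (joints z w))"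
      by (simp add: x_def y_def Blue)
    finally have deriv: "((\<lambda>z. separation q k (joints z v) (joints z w)) has_derivative
        (\<lambda>h. s * (constraint_normal q k (p v - p w) \<bullet> (joints h v - joints h w)))) (at (coords p))" .
    show ?thesis
      by (rule that[OF deriv]) (use x0 yp in \<open>simp add: s_def\<close>)
  qed
qed

text \<open>Each row is the gradient of one separation. Uniqueness of gradients then identifies
  rows, also across different graphs.\<close>

lemma rigidity_matrix_row_has_derivative:
  fixes G :: "'v::finite bigraph"
  assumes "1 < q" "framework G p"
  shows "((\<lambda>z. if e \<in> edges G then edge_separation q (joints z) e else 0) has_derivative
    (\<lambda>h. rigidity_matrix q G p $ e \<bullet> h)) (at (coords p))"
proof -
  have "(rigidity_map q G has_derivative (\<lambda>h. rigidity_matrix q G p *v h)) (at (coords p))"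
    using rigidity_map_differentiable[OF assms] jacobian_works unfolding rigidity_matrix_def by blast
  then have "((\<lambda>z. rigidity_map q G z $ e) has_derivative (\<lambda>h. (rigidity_matrix q G p *v h) $ e))
      (at (coords p))"
    by (rule bounded_linear.has_derivative[OF bounded_linear_vec_nth])
  then show ?thesis
    by (simp add: rigidity_map_def matrix_vector_mul_component)
qed

lemma has_derivative_inner_unique:
  fixes a b :: "'a::euclidean_space"
  assumes "(f has_derivative (\<lambda>h. a \<bullet> h)) (at x)" "(f has_derivative (\<lambda>h. b \<bullet> h)) (at x)"
  shows "a = b"
  using has_derivative_unique[OF assms] vector_eq_rdot[of a b] by (simp add: fun_eq_iff)

lemma rigidity_matrix_row_nonedge:
  fixes G :: "'v::finite bigraph"
  assumes "1 < q" "framework G p" "e \<notin> edges G"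
  shows "rigidity_matrix q G p $ e = 0"
  using has_derivative_inner_unique[OF _ rigidity_matrix_row_has_derivative[OF assms(1,2), of e], of 0] assms(3)
  by simp

lemma rigidity_matrix_row_eq:
  fixes G H :: "'v::finite bigraph"
  assumes "1 < q" "framework G p" "framework H p" "e \<in> edges G" "e \<in> edges H"
  shows "rigidity_matrix q G p $ e = rigidity_matrix q H p $ e"
  using has_derivative_inner_unique[OF rigidity_matrix_row_has_derivative[OF assms(1,2), of e]]
    rigidity_matrix_row_has_derivative[OF assms(1,3), of e] assms(4,5) by simp

lemma rigidity_matrix_row:
  fixes G :: "'v::finite bigraph"
  assumes q: "1 < q" and fw: "framework G p" and e: "e \<in> edges G"
  obtains s where "rigidity_matrix q G p $ e = s *\<^sub>R edge_row q p e"
    and "inj (\<lambda>v. p v $ 2) \<Longrightarrow> s \<noteq> 0"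
proof -
  obtain v w k where vw: "e = ({v, w}, k)" "v \<noteq> w" "v \<in> verts G" "w \<in> verts G"
    using fw e unfolding framework_def bicoloured_multigraph_def by fastforce
  then have "p v $ 1 \<noteq> p w $ 1"
    using fw unfolding framework_def placement_def inj_on_def by blast
  then obtain s where s: "((\<lambda>z. separation q k (joints z v) (joints z w)) has_derivative
      (\<lambda>h. s * (constraint_normal q k (p v - p w) \<bullet> (joints h v - joints h w)))) (at (coords p))"
    and nz: "p v $ 2 \<noteq> p w $ 2 \<Longrightarrow> s \<noteq> 0"
    using separation_has_derivative[OF q] by blast
  have "((\<lambda>z. edge_separation q (joints z) e) has_derivative (\<lambda>h. (s *\<^sub>R edge_row q p e) \<bullet> h)) (at (coords p))"
    using s vw by (simp add: edge_row_pair inner_pair_row)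
  then have "rigidity_matrix q G p $ e = s *\<^sub>R edge_row q p e"
    using has_derivative_inner_unique[OF rigidity_matrix_row_has_derivative[OF q fw, of e],
        of "s *\<^sub>R edge_row q p e"] e by simp
  moreover have "s \<noteq> 0" if "inj (\<lambda>v. p v $ 2)"
    using nz injD[OF that, of v w] vw(2) by blast
  ultimately show ?thesis using that by blast
qed

section \<open>Rank in terms of the rows of edges\<close>

lemma rank_rigidity_matrix:
  fixes G :: "'v::finite bigraph"
  assumes "1 < q" "framework G p"
  shows "rank (rigidity_matrix q G p) = dim ((\<lambda>e. rigidity_matrix q G p $ e) ` edges G)"
proof -
  have "rows (rigidity_matrix q G p) = range (\<lambda>e. rigidity_matrix q G p $ e)"
    by (auto simp: rows_def row_def)
  moreover have "span (range (\<lambda>e. rigidity_matrix q G p $ e)) =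
      span ((\<lambda>e. rigidity_matrix q G p $ e) ` edges G)"
  proof (rule antisym)
    have "range (\<lambda>e. rigidity_matrix q G p $ e) \<subseteq> span ((\<lambda>e. rigidity_matrix q G p $ e) ` edges G)"
    proof
      fix z assume "z \<in> range (\<lambda>e. rigidity_matrix q G p $ e)"
      then obtain e where e: "z = rigidity_matrix q G p $ e" by blast
      then show "z \<in> span ((\<lambda>e. rigidity_matrix q G p $ e) ` edges G)"
        by (cases "e \<in> edges G")
          (simp_all add: span_base rigidity_matrix_row_nonedge[OF assms] span_zero)
    qed
    then show "span (range (\<lambda>e. rigidity_matrix q G p $ e))
        \<subseteq> span ((\<lambda>e. rigidity_matrix q G p $ e) ` edges G)"
      by (intro span_minimal subspace_span)
  qed (intro span_mono, blast)
  ultimately show ?thesis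
    by (metis row_rank_def dim_span)
qed

lemma verts_delete_edge: "verts (delete_edge G e) = verts G"
  by (simp add: delete_edge_def)

lemma framework_delete_edge:
  "framework G p \<Longrightarrow> framework (delete_edge G e) p"
  by (auto simp: framework_def bicoloured_multigraph_def delete_edge_def)

lemma rank_delete_edge:
  fixes G :: "'v::finite bigraph"
  assumes "1 < q" "framework G p"
  shows "rank (rigidity_matrix q (delete_edge G e) p) =
    dim ((\<lambda>e. rigidity_matrix q G p $ e) ` (edges G - {e}))"
proof -
  have "(\<lambda>d. rigidity_matrix q (delete_edge G e) p $ d) ` edges (delete_edge G e) =
      (\<lambda>e. rigidity_matrix q G p $ e) ` (edges G - {e})"
    using rigidity_matrix_row_eq[OF assms(1) framework_delete_edge[OF assms(2)] assms(2)]
    by (intro image_cong) (auto simp: delete_edge_def)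
  then show ?thesis
    using rank_rigidity_matrix[OF assms(1) framework_delete_edge[OF assms(2)]] by simp
qed

text \<open>The identities say that rows are orthogonal to translations, are supported on their
  ends, and, if blue, are orthogonal to the dilation. All three persist if the scalar
  \<open>s\<close> is zero.\<close>

lemma joints_row_sum:
  fixes G :: "'v::finite bigraph"
  assumes q: "1 < q" and fw: "framework G p" and e: "e \<in> edges G"
  shows "(\<Sum>x\<in>UNIV. joints (rigidity_matrix q G p $ e) x) = 0"
    and "x \<notin> fst e \<Longrightarrow> joints (rigidity_matrix q G p $ e) x = 0"
    and "snd e = Blue \<Longrightarrow> rigidity_matrix q G p $ e \<bullet> coords p = 0"
proof -
  obtain v w k where vw: "e = ({v, w}, k)" "v \<noteq> w"
    using fw e unfolding framework_def bicoloured_multigraph_def by fastforce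
  obtain s where s: "rigidity_matrix q G p $ e = s *\<^sub>R edge_row q p e"
    using rigidity_matrix_row[OF assms] by blast
  show "(\<Sum>x\<in>UNIV. joints (rigidity_matrix q G p $ e) x) = 0"
    unfolding s joints_scaleR scaleR_sum_right[symmetric]
    by (simp add: vw edge_row_pair joints_pair_row sum_subtractf)
  show "x \<notin> fst e \<Longrightarrow> joints (rigidity_matrix q G p $ e) x = 0"
    unfolding s by (simp add: joints_scaleR joints_edge_row_not_incident)
  have "joints (coords p) = p"
    by (simp add: fun_eq_iff joints_def coords_def vec_eq_iff)
  then show "rigidity_matrix q G p $ e \<bullet> coords p = 0" if "snd e = Blue"
    using that unfolding s by (simp add: vw edge_row_pair inner_pair_row inner_vec2 algebra_simps)
qed

lemma joints_eq_0_imp: "(\<And>x. joints z x = 0) \<Longrightarrow> z = 0"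
  by (simp add: joints_def vec_eq_iff)

text \<open>A vector in the span is supported on \<open>X\<close> and its joints sum to zero, so the
  joint at one vertex \<open>x0\<close> is determined by the others; this saves two coordinates. For
  blue edges, orthogonality to the dilation saves a third.\<close>

lemma dim_rows_le:
  fixes G :: "'v::finite bigraph"
  assumes q: "1 < q" and fw: "framework G p" and F: "F \<subseteq> edges G" and X: "X \<noteq> {}"
    and FX: "\<And>e. e \<in> F \<Longrightarrow> fst e \<subseteq> X"
  shows "dim ((\<lambda>e. rigidity_matrix q G p $ e) ` F) + 2 \<le> 2 * card X"
    and "\<lbrakk>2 \<le> card X; X \<subseteq> verts G; \<And>e. e \<in> F \<Longrightarrow> snd e = Blue\<rbrakk> \<Longrightarrow>
      dim ((\<lambda>e. rigidity_matrix q G p $ e) ` F) + 3 \<le> 2 * card X"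
proof -
  let ?S = "(\<lambda>e. rigidity_matrix q G p $ e) ` F"
  obtain x0 where x0: "x0 \<in> X" using X by blast
  define T where "T = (X - {x0}) \<times> (UNIV :: 2 set)"
  have cardT: "card T + 2 = 2 * card X"
    using card_Suc_Diff1[OF finite x0] by (simp add: T_def card_cartesian_product)
  have span: "(\<Sum>x\<in>UNIV. joints z x) = 0" "x \<notin> X \<Longrightarrow> joints z x = 0" if "z \<in> span ?S" for z x
  proof -
    have "subspace {z. (\<Sum>x\<in>UNIV. joints z x) = 0 \<and> (\<forall>x. x \<notin> X \<longrightarrow> joints z x = 0)}"
      by (auto simp: subspace_def joints_add joints_scaleR sum.distrib scaleR_sum_right[symmetric])
        (auto simp: joints_def vec_eq_iff)
    then have "span ?S \<subseteq> {z. (\<Sum>x\<in>UNIV. joints z x) = 0 \<and> (\<forall>x. x \<notin> X \<longrightarrow> joints z x = 0)}"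
      using F FX joints_row_sum[OF q fw] by (intro span_minimal) blast+
    then show "(\<Sum>x\<in>UNIV. joints z x) = 0" "x \<notin> X \<Longrightarrow> joints z x = 0"
      using that by blast+
  qed
  have zero: "z = 0" if z: "z \<in> span ?S" "\<And>x. x \<in> X - {x0} \<Longrightarrow> joints z x = 0" for z
  proof (rule joints_eq_0_imp)
    fix x
    have other: "joints z x = 0" if "x \<noteq> x0" for x
      using span(2)[OF z(1), of x] z(2)[of x] that by blast
    then have "(\<Sum>x\<in>UNIV. joints z x) = (\<Sum>x\<in>{x0}. joints z x)"
      by (intro sum.mono_neutral_right) auto
    then have "joints z x0 = 0"
      using span(1)[OF z(1)] by simp
    then show "joints z x = 0"
      using other by (cases "x = x0") simp_all
  qed
  have "dim ?S \<le> card T"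
    by (intro dim_le_card_determining zero) (auto simp: T_def joints_def vec_eq_iff)
  then show "dim ?S + 2 \<le> 2 * card X"
    using cardT by simp
  assume two: "2 \<le> card X" and XV: "X \<subseteq> verts G" and blue: "\<And>e. e \<in> F \<Longrightarrow> snd e = Blue"
  have "X - {x0} \<noteq> {}"
  proof
    assume "X - {x0} = {}"
    then have "X = {x0}" using x0 by blast
    then show False using two by simp
  qed
  then obtain x1 where x1: "x1 \<in> X" "x1 \<noteq> x0" by blast
  then have px: "p x1 $ 1 \<noteq> p x0 $ 1"
    using fw x0 XV unfolding framework_def placement_def inj_on_def by blast
  have orth: "z \<bullet> coords p = 0" if "z \<in> span ?S" for z
  proof -
    have "subspace {z. z \<bullet> coords p = 0}"
      by (auto simp: subspace_def inner_add_left)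
    then have "span ?S \<subseteq> {z. z \<bullet> coords p = 0}"
      using F blue joints_row_sum(3)[OF q fw] by (intro span_minimal) blast+
    then show ?thesis using that by blast
  qed
  \<comment> \<open>The first coordinate at \<open>x1\<close> can be omitted because orthogonality
    to \<open>p\<close> recovers it: \<open>x0\<close> and \<open>x1\<close> have different first
    coordinates.\<close>
  have "dim ?S \<le> card (T - {(x1, 1)})"
  proof (rule dim_le_card_determining)
    fix z assume z: "z \<in> span ?S" and T: "\<And>j. j \<in> T - {(x1, 1)} \<Longrightarrow> z $ j = 0"
    have other: "joints z x = 0" if "x \<noteq> x0" "x \<noteq> x1" for x
    proof (cases "x \<in> X")
      case True
      then show ?thesis
        using that T[of "(x, _)"] by (auto simp: T_def joints_def vec_eq_iff)
    qed (use span(2)[OF z] in blast)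
    have y: "joints z x1 $ 2 = 0"
      using T[of "(x1, 2)"] x1 by (simp add: T_def joints_def)
    have "(\<Sum>x\<in>UNIV. joints z x) = (\<Sum>x\<in>{x0, x1}. joints z x)"
      using other by (intro sum.mono_neutral_right) auto
    then have sum: "joints z x0 = - joints z x1"
      using span(1)[OF z] x1 by (simp add: add_eq_0_iff2)
    \<comment> \<open>The joints at \<open>x0\<close> and \<open>x1\<close> are opposite, so only
      the difference of the two positions enters.\<close>
    have "z \<bullet> coords p = (\<Sum>x\<in>UNIV. joints z x \<bullet> p x)"
      by (simp add: inner_vec_prod2 joints_def coords_def)
    also have "\<dots> = (\<Sum>x\<in>{x0, x1}. joints z x \<bullet> p x)"
      using other by (intro sum.mono_neutral_right) auto
    also have "\<dots> = joints z x1 $ 1 * (p x1 $ 1 - p x0 $ 1)"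
      using x1 y by (simp add: sum inner_vec2 algebra_simps)
    finally have "joints z x1 $ 1 = 0"
      using orth[OF z] px by simp
    then have "joints z x1 = 0"
      using y by (simp add: vec2_eq_iff)
    then show "z = 0"
      using other by (intro zero[OF z]) (metis DiffD2 singletonI)
  qed
  moreover have "(x1, 1) \<in> T"
    using x1 by (simp add: T_def)
  ultimately show "dim ?S + 3 \<le> 2 * card X"
    using cardT card_Suc_Diff1[of T "(x1, 1)"] by simp
qed

section \<open>From counts of subgraphs to counts of vertex sets\<close>

lemma subgraphI:
  assumes "bicoloured_multigraph G" "F \<subseteq> edges G" "\<And>e. e \<in> F \<Longrightarrow> fst e \<subseteq> X" "X \<inter> verts G \<noteq> {}"
  shows "subgraph \<lparr>verts = X \<inter> verts G, edges = F\<rparr> G"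
proof -
  have "\<exists>v w. fst e = {v, w} \<and> v \<noteq> w \<and> v \<in> X \<inter> verts G \<and> w \<in> X \<inter> verts G" if "e \<in> F" for e
  proof -
    have "e \<in> edges G" using assms(2) that by blast
    then obtain v w where "fst e = {v, w}" "v \<noteq> w" "v \<in> verts G" "w \<in> verts G"
      using assms(1) unfolding bicoloured_multigraph_def by fastforce
    then show ?thesis using assms(3)[OF that] by blast
  qed
  then show ?thesis
    using assms unfolding subgraph_def bicoloured_multigraph_def by fastforce
qed

text \<open>\<open>X\<close> ranges over all subsets of the vertex type. Elements outside
  \<open>verts G\<close> only weaken the bound, so the subgraph on \<open>X \<inter> verts G\<close>
  suffices.\<close>

lemma sparse2_limited23_imp_count_sparse:
  fixes G :: "'v::finite bigraph"
  assumes G: "bicoloured_multigraph G" and sp: "sparse2 2 G" and lim: "limited23 G"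
  shows "count_sparse (edges G)"
proof -
  have edge: "fst e \<inter> verts G \<noteq> {}" if "e \<in> edges G" for e
    using G that unfolding bicoloured_multigraph_def by fastforce
  have sub: "subgraph \<lparr>verts = X \<inter> verts G, edges = induced_edges F X\<rparr> G"
    if "F \<subseteq> edges G" "induced_edges F X \<noteq> {}" for F X
    using that edge by (intro subgraphI[OF G]) (auto simp: induced_edges_def, blast)
  have le: "card (X \<inter> verts G) \<le> card X" for X
    by (simp add: card_mono)
  show ?thesis
    unfolding count_sparse_def
  proof (intro conjI allI impI)
    fix X :: "'v set" assume "X \<noteq> {}"
    then have "card X > 0" by (simp add: card_gt_0_iff)
    then show "card (induced_edges (edges G) X) + 2 \<le> 2 * card X"
    proof (cases "induced_edges (edges G) X = {}")
      case False
      then have "int (card (induced_edges (edges G) X)) \<le> 2 * int (card (X \<inter> verts G)) - 2"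
        using sp sub[of "edges G" X] unfolding sparse2_def by (fastforce simp: card_gt_0_iff)
      then show ?thesis using le[of X] by linarith
    qed simp
  next
    fix X :: "'v set" assume "2 \<le> card X"
    then show "card (induced_edges (blue_edges (edges G)) X) + 3 \<le> 2 * card X"
    proof (cases "induced_edges (blue_edges (edges G)) X = {}")
      case False
      let ?H = "\<lparr>verts = X \<inter> verts G, edges = induced_edges (blue_edges (edges G)) X\<rparr>"
      have H: "subgraph ?H G"
        using sub[OF blue_edges_subset False] .
      then have "sparse2 3 ?H"
        using lim unfolding limited23_def by (auto simp: induced_edges_def blue_edges_def)
      moreover have "subgraph ?H ?H"
        using H by (simp add: subgraph_def)
      ultimately have "int (card (edges ?H)) \<le> 2 * int (card (verts ?H)) - 3"
        using False unfolding sparse2_def by (auto simp: card_gt_0_iff dest!: spec[of _ ?H])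
      then show ?thesis using le[of X] by simp
    qed simp
  qed
qed

theorem theorem5p3:
  fixes q :: real
    and G :: "'v::finite bigraph"
    and p :: "'v \<Rightarrow> real^2"
  assumes "1 < q" and "q \<noteq> 2"
    and "bicoloured_multigraph G"
    and "framework G p"
    and "completely_regular q G p"
  shows "minimally_rigid q G p \<longleftrightarrow> tight2 2 G \<and> limited23 G"
proof -
  note q = assms(1) and G = assms(3) and fw = assms(4)
  define t where "t e = rigidity_matrix q G p $ e" for e
  note rank = rank_rigidity_matrix[OF q fw, folded t_def]
  note rank_del = rank_delete_edge[OF q fw, folded t_def]
  note dim_le = dim_rows_le[OF q fw, folded t_def]
  show ?thesis
  proof
    assume rigid: "minimally_rigid q G p"
    \<comment> \<open>An edge with a redundant row could be deleted without loss of rank, against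
      minimality.\<close>
    have ind: "indep_family t (edges G)"
      unfolding indep_family_def
    proof (intro ballI notI)
      fix e assume e: "e \<in> edges G" and "t e \<in> span (t ` (edges G - {e}))"
      then have "span (insert (t e) (t ` (edges G - {e}))) = span (t ` (edges G - {e}))"
        by (intro span_redundant)
      moreover have "insert (t e) (t ` (edges G - {e})) = t ` edges G"
        using e by blast
      ultimately have "dim (t ` edges G) = dim (t ` (edges G - {e}))"
        by (metis dim_span)
      then show False
        using rigid e rank rank_del[of e] unfolding minimally_rigid_def rigid_def verts_delete_edge
        by metis
    qed
    have count: "dim (t ` F) = card F" if "F \<subseteq> edges G" for F
      by (rule indep_family_dim[OF finite indep_family_mono[OF ind that]])
    have sub: "\<And>e. e \<in> edges H \<Longrightarrow> fst e \<subseteq> verts H" "verts H \<noteq> {}" if "subgraph H G" for H :: "'v bigraph"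
      using that unfolding subgraph_def bicoloured_multigraph_def by fastforce+
    have "sparse2 2 G"
      unfolding sparse2_def
    proof (intro allI impI)
      fix H :: "'v bigraph" assume H: "subgraph H G \<and> card (edges H) > 0"
      then have "edges H \<subseteq> edges G" by (simp add: subgraph_def)
      then have "card (edges H) + 2 \<le> 2 * card (verts H)"
        using dim_le(1)[of "edges H" "verts H"] sub[of H] H count by simp
      then show "int (card (edges H)) \<le> 2 * int (card (verts H)) - 2" by linarith
    qed
    moreover have "int (card (edges G)) = 2 * int (card (verts G)) - 2"
      using rigid rank count[of "edges G"] by (simp add: minimally_rigid_def rigid_def)
    moreover have "limited23 G"
      unfolding limited23_def sparse2_def
    proof (intro allI impI)
      fix H K :: "'v bigraph"
      assume H: "subgraph H G \<and> (\<forall>(e, c)\<in>edges H. c = Blue)"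
        and K: "subgraph K H \<and> card (edges K) > 0"
      then have KG: "subgraph K G" "edges K \<subseteq> edges G" "verts K \<subseteq> verts G"
        and blue: "\<And>e. e \<in> edges K \<Longrightarrow> snd e = Blue"
        by (fastforce simp: subgraph_def)+
      obtain e where "e \<in> edges K" using K by (metis card_gt_0_iff ex_in_conv)
      then obtain v w where "v \<in> verts K" "w \<in> verts K" "v \<noteq> w"
        using K unfolding subgraph_def bicoloured_multigraph_def by fastforce
      then have "2 \<le> card (verts K)"
        by (rule two_le_cardI)
      then have "card (edges K) + 3 \<le> 2 * card (verts K)"
        using dim_le(2)[OF KG(2) sub(2,1)[OF KG(1)] _ KG(3) blue] count[OF KG(2)] by simp
      then show "int (card (edges K)) \<le> 2 * int (card (verts K)) - 3" by linarith
    qed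
    ultimately show "tight2 2 G \<and> limited23 G"
      by (simp add: tight2_def)
  next
    assume tight: "tight2 2 G \<and> limited23 G"
    then have "count_sparse (edges G)"
      using sparse2_limited23_imp_count_sparse[OF G] by (simp add: tight2_def)
    moreover have "card (fst e) = 2" if "e \<in> edges G" for e
      using G that unfolding bicoloured_multigraph_def by fastforce
    ultimately obtain p0 where "indep_family (edge_row q p0) (edges G)"
      using count_sparse_imp_indep_family[OF q assms(2)] by metis
    \<comment> \<open>General position turns \<open>p'\<close> into a genuine placement whose row
      scalars are all nonzero.\<close>
    then obtain p' where ind: "indep_family (edge_row q p') (edges G)" and gp: "general_position p'"
      using indep_family_general_position[OF q] by metis
    have place: "placement (verts G) p'"
      using gp unfolding placement_def inj_on_def general_position_def by blast
    then have fw': "framework G p'"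
      using G by (simp add: framework_def)
    have inj: "inj (\<lambda>v. p' v $ 2)"
      using gp unfolding inj_def general_position_def by blast
    have "\<exists>s. s \<noteq> 0 \<and> rigidity_matrix q G p' $ e = s *\<^sub>R edge_row q p' e" if "e \<in> edges G" for e
      using rigidity_matrix_row[OF q fw' that] inj by metis
    then obtain s where "\<And>e. e \<in> edges G \<Longrightarrow> s e \<noteq> 0"
      and "\<And>e. e \<in> edges G \<Longrightarrow> rigidity_matrix q G p' $ e = s e *\<^sub>R edge_row q p' e"
      by metis
    then have "indep_family (\<lambda>e. rigidity_matrix q G p' $ e) (edges G)"
      by (rule indep_family_scale[OF finite ind])
    then have "rank (rigidity_matrix q G p') = card (edges G)"
      by (simp add: rank_rigidity_matrix[OF q fw'] indep_family_dim)
    moreover have "subgraph G (complete_bigraph (verts G))"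
      using G unfolding subgraph_def complete_bigraph_def bicoloured_multigraph_def by fastforce
    \<comment> \<open>Complete regularity is applied with H = G itself and compares \<open>p\<close>
      with \<open>p'\<close>.\<close>
    ultimately have "card (edges G) \<le> dim (t ` edges G)"
      using assms(5) place rank unfolding completely_regular_def by metis
    moreover have upper: "dim (t ` F) \<le> card F" for F
      using dim_le_card'[of "t ` F"] card_image_le[of F t] by simp
    ultimately have full: "dim (t ` edges G) = card (edges G)"
      using order_antisym by blast
    have less: "card (edges G - {e}) < card (edges G)" if "e \<in> edges G" for e
      by (rule card_Diff1_less[OF finite that])
    \<comment> \<open>After a deletion fewer rows remain than the rank that rigidity
      requires.\<close>
    have "dim (t ` (edges G - {e})) < dim (t ` edges G)" if "e \<in> edges G" for e
      using upper[of "edges G - {e}"] less[OF that] full by simp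
    then show "minimally_rigid q G p"
      using tight full rank rank_del unfolding minimally_rigid_def rigid_def tight2_def verts_delete_edge
      by (metis less_irrefl of_nat_eq_iff)
  qed
qed

end
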